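(* Let $T>0$, $\sigma>0$ and $\beta\in\mathbb{R}$ be constants. Let $F:[0,T]\times\mathbb{R}_{\ge 0}\times\mathbb{R}\to\mathbb{R}$ and $g:\mathbb{R}_{\ge 0}\to\mathbb{R}$ be Lebesgue measurable and with linear growth. Suppose that there exists $L>0$ such that $$|F(t,S,f)-F(t,S',h)|\le L\,(|S-S'|+|f-h|)\qquad \text{for all } t\in[0,T],\ S,S'\in\mathbb{R}_{\ge 0},\ f,h\in\mathbb{R}.$$ Then the map $J:\mathcal{X}\to\mathcal{X}$ given by $$J(x)(t,S):=\int_0^\infty \Gamma(t,S,T,z)\,g(z)\,dz-\int_t^T\int_0^\infty \Gamma(t,S,u,z)\,F(u,z,x(u,z))\,dz\,du$$ is well-defined, and there exists $k\in\mathbb{N}$ such that the $k$-fold composition $J^k$ satisfies $$\|J^k(x)-J^k(y)\|_{\mathcal{X}}<\|x-y\|_{\mathcal{X}}\qquad\text{for all } x,y\in\mathcal{X},\ x\neq y.$$ Accordingly, the mild equation $$\hat V(t,S)=\int_0^\infty \Gamma(t,S,T,z)\,g(z)\,dz-\int_t^T\int_0^\infty \Gamma(t,S,u,z)\,F(u,z,\hat V(u,z))\,dz\,du$$ admits a unique solution $\hat V$ in $\mathcal{X}$.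
   Context: $\mathbb{R}^+=(0,\infty)$. $\mathcal{X}$ is the Banach space of (equivalence classes of a.e. equal) measurable functions $x:[0,T]\times\mathbb{R}^+\to\mathbb{R}$ such that $x/(1+S)\in L^\infty([0,T]\times\mathbb{R}^+)$, with norm $\|x\|_{\mathcal{X}}=\operatorname{ess\,sup}_{(t,S)}\left|\frac{x(t,S)}{1+S}\right|$. Linear growth means: there is $c>0$ with $|F(t,S,f)|\le c(1+|S|+|f|)$ for all $(t,S,f)$, and $|g(S)|\le c(1+S)$ for all $S\geq 0$. $\Gamma$ is the fundamental solution of the operator $\partial_t+\beta S\,\partial_S+\tfrac12\sigma^2S^2\,\partial_{SS}$, namely, for $0\le t<u\le T$ and $S>0$, $$\Gamma(t,S,u,z)=\frac{z^{-1}}{\sqrt{2\pi\sigma^2(u-t)}}\exp\left(-\frac{\left[\ln\frac{z}{S}-\left(\beta-\frac{\sigma^2}{2}\right)(u-t)\right]^2}{2\sigma^2(u-t)}\right)\mathbf{1}_{z>0},$$ i.e. the density at time $u$ of a geometric Brownian motion with drift $\beta$ and volatility $\sigma$ started from $S$ at time $t$. *)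

theory Defs
  imports "HOL-Probability.Essential_Supremum"
begin

section \<open>The Banach space of classes of functions of linear growth\<close>

definition X_meas :: "real \<Rightarrow> (real \<times> real) measure" where
  "X_meas T = lebesgue_on ({0..T} \<times> {0<..})"

text \<open>
  Representatives are total functions on pairs \<open>(t, S)\<close>; their values outside of the domain
  \<open>[0,T] \<times> (0,\<infinity>)\<close> are irrelevant. The elements of the space proper are the classes in \<open>X_space\<close>,
  and operations on classes are lifted from representatives.
\<close>

definition rep_esssup :: "real \<Rightarrow> (real \<times> real \<Rightarrow> real) \<Rightarrow> ereal" where
  "rep_esssup T x = esssup (X_meas T) (\<lambda>(t, S). ereal \<bar>x (t, S) / (1 + S)\<bar>)"

definition X_fun :: "real \<Rightarrow> (real \<times> real \<Rightarrow> real) set" where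
  "X_fun T = {x \<in> borel_measurable (X_meas T). rep_esssup T x < \<infinity>}"

definition X_rel :: "real \<Rightarrow> ((real \<times> real \<Rightarrow> real) \<times> (real \<times> real \<Rightarrow> real)) set" where
  "X_rel T = {(x, y). x \<in> X_fun T \<and> y \<in> X_fun T \<and> (AE p in X_meas T. x p = y p)}"

definition X_space :: "real \<Rightarrow> (real \<times> real \<Rightarrow> real) set set" where
  "X_space T = X_fun T // X_rel T"

definition X_diff ::
  "real \<Rightarrow> (real \<times> real \<Rightarrow> real) set \<Rightarrow> (real \<times> real \<Rightarrow> real) set \<Rightarrow> (real \<times> real \<Rightarrow> real) set" where
  "X_diff T A B = (\<Union>x\<in>A. \<Union>y\<in>B. X_rel T `` {\<lambda>p. x p - y p})"

definition X_norm :: "real \<Rightarrow> (real \<times> real \<Rightarrow> real) set \<Rightarrow> real" where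
  "X_norm T A = the_elem ((\<lambda>x. real_of_ereal (rep_esssup T x)) ` A)"

lemma equiv_X_rel: "equiv (X_fun T) (X_rel T)"
proof (rule equivI)
  show "X_rel T \<subseteq> X_fun T \<times> X_fun T" by (auto simp: X_rel_def)
  show "refl_on (X_fun T) (X_rel T)" by (auto simp: X_rel_def refl_on_def)
  show "sym (X_rel T)"
  proof (rule symI)
    fix x y assume *: "(x, y) \<in> X_rel T"
    then have "AE p in X_meas T. x p = y p" by (simp add: X_rel_def)
    then have "AE p in X_meas T. y p = x p" by eventually_elim simp
    with * show "(y, x) \<in> X_rel T" by (simp add: X_rel_def)
  qed
  show "trans (X_rel T)"
  proof (rule transI)
    fix x y z assume *: "(x, y) \<in> X_rel T" "(y, z) \<in> X_rel T"
    then have "AE p in X_meas T. x p = y p" "AE p in X_meas T. y p = z p"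
      by (simp_all add: X_rel_def)
    then have "AE p in X_meas T. x p = z p" by eventually_elim simp
    with * show "(x, z) \<in> X_rel T" by (simp add: X_rel_def)
  qed
qed

lemma rep_esssup_cong:
  assumes "(x, y) \<in> X_rel T"
  shows "rep_esssup T x = rep_esssup T y"
proof -
  have meas: "(\<lambda>(t, S). ereal \<bar>w (t, S) / (1 + S)\<bar>) \<in> borel_measurable (X_meas T)"
    if "w \<in> X_fun T" for w
  proof (rule ccontr)
    assume "\<not> ?thesis"
    then have "rep_esssup T w = top"
      unfolding rep_esssup_def by (rule esssup_non_measurable)
    with that show False by (simp add: X_fun_def top_ereal_def)
  qed
  have "AE p in X_meas T. x p = y p" using assms by (auto simp: X_rel_def)
  then have "AE p in X_meas T. (\<lambda>(t, S). ereal \<bar>x (t, S) / (1 + S)\<bar>) p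
      = (\<lambda>(t, S). ereal \<bar>y (t, S) / (1 + S)\<bar>) p"
    by eventually_elim (simp add: case_prod_unfold)
  then show ?thesis
    unfolding rep_esssup_def using assms
    by (intro esssup_AE_cong meas) (simp_all add: X_rel_def)
qed

lemma X_norm_class:
  assumes "x \<in> X_fun T"
  shows "X_norm T (X_rel T `` {x}) = real_of_ereal (rep_esssup T x)"
proof -
  have mem: "x \<in> X_rel T `` {x}" using assms by (simp add: X_rel_def)
  have eq: "rep_esssup T y = rep_esssup T x" if "y \<in> X_rel T `` {x}" for y
    using rep_esssup_cong[of x y T] that by simp
  have "(\<lambda>y. real_of_ereal (rep_esssup T y)) ` (X_rel T `` {x})
      = {real_of_ereal (rep_esssup T x)}" (is "?f ` ?A = {?c}")
  proof (rule equalityI)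
    show "?f ` ?A \<subseteq> {?c}" by (rule image_subsetI) (simp only: eq singleton_iff)
    show "{?c} \<subseteq> ?f ` ?A" using imageI[OF mem, of ?f] by (simp only: insert_subset empty_subsetI simp_thms)
  qed
  then show ?thesis unfolding X_norm_def by (simp only: the_elem_eq)
qed

lemma X_fun_diff:
  assumes x: "x \<in> X_fun T" and y: "y \<in> X_fun T"
  shows "(\<lambda>p. x p - y p) \<in> X_fun T"
proof -
  let ?q = "\<lambda>w (t, S). ereal \<bar>w (t, S) / (1 + S)\<bar>"
  let ?d = "\<lambda>p. x p - y p"
  have d: "?d \<in> borel_measurable (X_meas T)"
    using x y unfolding X_fun_def by (simp add: borel_measurable_diff)
  have "(snd :: real \<times> real \<Rightarrow> real) \<in> borel_measurable borel"
    by (rule borel_measurable_continuous_onI) (intro continuous_intros)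
  then have "(snd :: real \<times> real \<Rightarrow> real) \<in> borel_measurable (X_meas T)"
    unfolding X_meas_def by (intro measurable_restrict_space1 measurable_completion) simp
  with d have "(\<lambda>p. ereal \<bar>?d p / (1 + snd p)\<bar>) \<in> borel_measurable (X_meas T)"
    by (intro borel_measurable_ereal borel_measurable_abs borel_measurable_divide
        borel_measurable_add borel_measurable_const)
  then have "?q ?d \<in> borel_measurable (X_meas T)" by (simp only: case_prod_unfold prod.collapse)
  moreover have "?q ?d p \<le> ?q x p + ?q y p" for p
    by (cases p) (simp add: abs_divide add_divide_distrib[symmetric] divide_right_mono abs_triangle_ineq4)
  ultimately have "rep_esssup T ?d \<le> esssup (X_meas T) (\<lambda>p. ?q x p + ?q y p)"
    unfolding rep_esssup_def by (rule esssup_mono)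
  also have "\<dots> \<le> rep_esssup T x + rep_esssup T y"
    unfolding rep_esssup_def by (rule esssup_add)
  also have "\<dots> < \<infinity>" using x y unfolding X_fun_def by simp
  finally show ?thesis using d unfolding X_fun_def by simp
qed

lemma X_diff_class:
  assumes "x \<in> X_fun T" and "y \<in> X_fun T"
  shows "X_diff T (X_rel T `` {x}) (X_rel T `` {y}) = X_rel T `` {\<lambda>p. x p - y p}"
  unfolding X_diff_def
proof (rule UN_equiv_class2[OF equiv_X_rel equiv_X_rel _ assms], rule congruent2I')
  fix x1 x2 y1 y2 assume *: "(x1, x2) \<in> X_rel T" "(y1, y2) \<in> X_rel T"
  then have "AE p in X_meas T. x1 p = x2 p" "AE p in X_meas T. y1 p = y2 p"
    by (simp_all add: X_rel_def)
  then have "AE p in X_meas T. x1 p - y1 p = x2 p - y2 p" by eventually_elim simp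
  with * have "(\<lambda>p. x1 p - y1 p, \<lambda>p. x2 p - y2 p) \<in> X_rel T"
    using X_fun_diff by (simp add: X_rel_def)
  then show "X_rel T `` {\<lambda>p. x1 p - y1 p} = X_rel T `` {\<lambda>p. x2 p - y2 p}"
    by (rule equiv_class_eq[OF equiv_X_rel])
qed

section \<open>The fundamental solution and the integral operator\<close>

definition gbm_Gamma :: "real \<Rightarrow> real \<Rightarrow> real \<Rightarrow> real \<Rightarrow> real \<Rightarrow> real \<Rightarrow> real" where
  "gbm_Gamma \<sigma> \<beta> t S u z =
     inverse z / sqrt (2 * pi * \<sigma>\<^sup>2 * (u - t))
     * exp (- ((ln (z / S) - (\<beta> - \<sigma>\<^sup>2 / 2) * (u - t))\<^sup>2 / (2 * \<sigma>\<^sup>2 * (u - t))))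
     * indicator {0<..} z"

text \<open>
  The kernel is meaningful for \<open>t < u\<close> only. For \<open>t = u\<close>, division by zero makes it \<open>0\<close>, so that
  \<open>J_fun\<close> vanishes on the null set \<open>t = T\<close>. Integrals are with respect to the completed measure,
  since the sections of a Lebesgue measurable function need not be Borel measurable.
\<close>

definition J_fun ::
  "real \<Rightarrow> real \<Rightarrow> real \<Rightarrow> (real \<Rightarrow> real \<Rightarrow> real \<Rightarrow> real) \<Rightarrow> (real \<Rightarrow> real)
    \<Rightarrow> (real \<times> real \<Rightarrow> real) \<Rightarrow> real \<times> real \<Rightarrow> real" where
  "J_fun T \<sigma> \<beta> F g x = (\<lambda>(t, S).
     (LINT z:{0<..}|lebesgue. gbm_Gamma \<sigma> \<beta> t S T z * g z)
     - (LINT u:{t..T}|lebesgue. LINT z:{0<..}|lebesgue.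
          gbm_Gamma \<sigma> \<beta> t S u z * F u z (x (u, z))))"

definition J_integrals_exist ::
  "real \<Rightarrow> real \<Rightarrow> real \<Rightarrow> (real \<Rightarrow> real \<Rightarrow> real \<Rightarrow> real) \<Rightarrow> (real \<Rightarrow> real)
    \<Rightarrow> (real \<times> real \<Rightarrow> real) \<Rightarrow> real \<Rightarrow> real \<Rightarrow> bool" where
  "J_integrals_exist T \<sigma> \<beta> F g x t S \<longleftrightarrow>
     set_integrable lebesgue {0<..} (\<lambda>z. gbm_Gamma \<sigma> \<beta> t S T z * g z)
     \<and> (AE u in lebesgue_on {t..T}.
          set_integrable lebesgue {0<..} (\<lambda>z. gbm_Gamma \<sigma> \<beta> t S u z * F u z (x (u, z))))
     \<and> set_integrable lebesgue {t..T}
          (\<lambda>u. LINT z:{0<..}|lebesgue. gbm_Gamma \<sigma> \<beta> t S u z * F u z (x (u, z)))"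

definition J ::
  "real \<Rightarrow> real \<Rightarrow> real \<Rightarrow> (real \<Rightarrow> real \<Rightarrow> real \<Rightarrow> real) \<Rightarrow> (real \<Rightarrow> real)
    \<Rightarrow> (real \<times> real \<Rightarrow> real) set \<Rightarrow> (real \<times> real \<Rightarrow> real) set" where
  "J T \<sigma> \<beta> F g A = (\<Union>x\<in>A. X_rel T `` {J_fun T \<sigma> \<beta> F g x})"

end

theory Submission
  imports Defs "HOL-Probability.Distributions"
begin

text \<open>
  Put \<open>\<phi>(t) = ess sup |x(t, S) - y(t, S)| / (1 + S)\<close> over \<open>S > 0\<close>. The density \<open>\<Gamma>(t, S, u, \<cdot>)\<close> is
  log-normal, with mass \<open>1\<close> and mean \<open>S e\<^bsup>\<beta>(u - t)\<^esup>\<close>, so integrating the weight \<open>1 + z\<close> against it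
  reproduces \<open>1 + S\<close> up to the factor \<open>E = e\<^bsup>|\<beta>|T\<^esup>\<close>. Together with the Lipschitz condition this gives
  a Volterra inequality
  \<open>|J x (t, S) - J y (t, S)| \<le> E L (1 + S) \<integral> \<phi>(u) du\<close> over \<open>u\<close> from \<open>t\<close> to \<open>T\<close> (\<open>Jf_lipschitz\<close>).
  Because the time integral starts at \<open>t\<close>, iterating does better than taking powers of a constant:
  the \<open>k\<close>-th iterate is Lipschitz with constant \<open>(E L T)\<^sup>k / k!\<close> (\<open>Jf_pow_bound\<close>), which tends to \<open>0\<close>.
  This is the strict contraction. Since these constants are summable, the Picard iterates started
  at \<open>0\<close> converge in the weighted norm to a fixed point, and the same bound with \<open>k \<rightarrow> \<infinity>\<close>
  forces two fixed points to coincide.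

  The delicate part is measurability. The map \<open>F\<close> is Lebesgue measurable in all three
  variables jointly, and such a function may lose measurability when composed with
  \<open>(u, z) \<mapsto> (u, z, x(u, z))\<close>, whose range is a null set. Here the Lipschitz condition helps:
  \<open>F t\<close> is determined by its values at countably many points, at each of which it agrees with a Borel
  function of \<open>t\<close> almost everywhere, and it is recovered from them by an infimal convolution. Hence \<open>F\<close> coincides, outside a
  null set of times, with a jointly Borel function (\<open>lipschitz_borel_modification\<close>). With this,
  \<open>x \<mapsto> F(\<cdot>, \<cdot>, x)\<close> maps the space into itself, and \<open>J\<close> splits into
  a terminal term, this superposition, and the linear Duhamel integral of a source
  (\<open>duhamel_estimates\<close>). For the last one, Fubini's theorem replaces the source by a Borel
  representative on almost every time slice.
\<close>

section \<open>The kernel: total mass and mean\<close>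

text \<open>
  The logarithm of the terminal price is normally distributed; \<open>exp y\<close> on the left is the Jacobian
  of \<open>z = exp y\<close>.
\<close>

lemma Gamma_lognormal:
  assumes "\<sigma> > 0" "t < u" "S > 0"
  shows "gbm_Gamma \<sigma> \<beta> t S u (exp y) * exp y
       = normal_density (ln S + (\<beta> - \<sigma>\<^sup>2 / 2) * (u - t)) (\<sigma> * sqrt (u - t)) y"
proof -
  have 1: "ln (exp y / S) - (\<beta> - \<sigma>\<^sup>2 / 2) * (u - t) = y - (ln S + (\<beta> - \<sigma>\<^sup>2 / 2) * (u - t))"
    using assms by (simp add: ln_div)
  have 2: "(\<sigma> * sqrt (u - t))\<^sup>2 = \<sigma>\<^sup>2 * (u - t)"
    using assms by (simp add: power_mult_distrib)
  have 3: "inverse (exp y) / d * e * 1 * exp y = 1 / d * e" for d e :: real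
    by simp
  show ?thesis
    unfolding gbm_Gamma_def normal_density_def 1 2
    using 3 by (simp add: mult.assoc)
qed

text \<open>
  Completing the square: an exponential tilt of a Gaussian is a shifted Gaussian. It reduces the
  mean of a log-normal law to the total mass of a normal law.
\<close>

lemma exp_normal_density:
  assumes "s > 0"
  shows "exp y * normal_density m s y = exp (m + s\<^sup>2 / 2) * normal_density (m + s\<^sup>2) s y"
proof -
  have "y + - (y - m)\<^sup>2 / (2 * s\<^sup>2) = (m + s\<^sup>2 / 2) + - (y - (m + s\<^sup>2))\<^sup>2 / (2 * s\<^sup>2)"
    using assms by (simp add: field_simps power2_eq_square)
  then have "exp y * exp (- (y - m)\<^sup>2 / (2 * s\<^sup>2))
      = exp (m + s\<^sup>2 / 2) * exp (- (y - (m + s\<^sup>2))\<^sup>2 / (2 * s\<^sup>2))"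
    by (simp only: exp_add[symmetric])
  then show ?thesis unfolding normal_density_def by (simp add: field_simps)
qed

text \<open>
  The substitution \<open>z = exp y\<close> carries the whole line onto \<open>{0<..}\<close>, the set outside of which \<open>f\<close> vanishes.
\<close>

lemma has_bochner_integral_exp_substitution:
  fixes f :: "real \<Rightarrow> real"
  assumes f: "f \<in> borel_measurable borel" and zero: "\<And>z. z \<le> 0 \<Longrightarrow> f z = 0"
    and I: "has_bochner_integral lborel (\<lambda>y. exp y * f (exp y)) b"
  shows "has_bochner_integral lborel f b"
proof -
  have r: "range exp = {0::real<..}"
    by (auto simp: image_iff) (metis exp_ln)
  have I': "has_bochner_integral lebesgue (\<lambda>y. exp y * f (exp y)) b"
    using I f by (simp add: has_bochner_integral_iff integrable_completion integral_completion)
  have 1: "(\<lambda>y. \<bar>exp y\<bar> * f (exp y)) absolutely_integrable_on UNIV"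
    using I' by (simp add: set_integrable_def has_bochner_integral_iff)
  moreover have "integral UNIV (\<lambda>y. \<bar>exp y\<bar> * f (exp y)) = b"
    using set_lebesgue_integral_eq_integral(2)[OF 1] I'
    by (simp add: set_lebesgue_integral_def has_bochner_integral_iff)
  ultimately have *: "f absolutely_integrable_on {0<..} \<and> integral {0<..} f = b"
    using has_absolute_integral_change_of_variables_1'[of UNIV exp exp f b]
    by (auto simp: r inj_on_def intro!: derivative_eq_intros)
  have eq: "indicator {0<..} z * f z = f z" for z
    using zero[of z] by (auto simp: indicator_def)
  have "integrable lebesgue f"
    using * by (simp add: set_integrable_def eq)
  moreover have "integral\<^sup>L lebesgue f = b"
    using * set_lebesgue_integral_eq_integral(2)[of "{0<..}" f] by (simp add: set_lebesgue_integral_def eq)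
  ultimately show ?thesis
    using f by (simp add: has_bochner_integral_iff integrable_completion integral_completion)
qed

lemma Gamma_measurable:
  assumes [measurable]: "t \<in> borel_measurable M" "S \<in> borel_measurable M"
    "u \<in> borel_measurable M" "z \<in> borel_measurable M"
  shows "(\<lambda>w. gbm_Gamma \<sigma> \<beta> (t w) (S w) (u w) (z w)) \<in> borel_measurable M"
  unfolding gbm_Gamma_def by measurable

lemma Gamma_mass:
  assumes "\<sigma> > 0" "t < u" "S > 0"
  shows "has_bochner_integral lborel (gbm_Gamma \<sigma> \<beta> t S u) 1"
proof (rule has_bochner_integral_exp_substitution)
  show "gbm_Gamma \<sigma> \<beta> t S u \<in> borel_measurable borel"
    by (rule Gamma_measurable) simp_all
  show "gbm_Gamma \<sigma> \<beta> t S u z = 0" if "z \<le> 0" for z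
    using that by (simp add: gbm_Gamma_def)
  show "has_bochner_integral lborel (\<lambda>y. exp y * gbm_Gamma \<sigma> \<beta> t S u (exp y)) 1"
    using assms
    by (subst mult.commute) (simp add: Gamma_lognormal[OF assms] has_bochner_integral_iff
        integrable_normal_density integral_normal_density)
qed

lemma Gamma_mean:
  assumes "\<sigma> > 0" "t < u" "S > 0"
  shows "has_bochner_integral lborel (\<lambda>z. gbm_Gamma \<sigma> \<beta> t S u z * z) (S * exp (\<beta> * (u - t)))"
proof (rule has_bochner_integral_exp_substitution)
  show "(\<lambda>z. gbm_Gamma \<sigma> \<beta> t S u z * z) \<in> borel_measurable borel"
    by (intro borel_measurable_times Gamma_measurable) simp_all
  show "gbm_Gamma \<sigma> \<beta> t S u z * z = 0" if "z \<le> 0" for z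
    using that by (simp add: gbm_Gamma_def)
  define m s where "m = ln S + (\<beta> - \<sigma>\<^sup>2 / 2) * (u - t)" and "s = \<sigma> * sqrt (u - t)"
  have s: "s > 0" using assms by (simp add: s_def)
  have "s\<^sup>2 = \<sigma>\<^sup>2 * (u - t)"
    using assms by (simp add: s_def power_mult_distrib)
  then have "m + s\<^sup>2 / 2 = ln S + \<beta> * (u - t)" by (simp add: m_def algebra_simps)
  then have c: "exp (m + s\<^sup>2 / 2) = S * exp (\<beta> * (u - t))"
    using assms by (simp add: exp_add)
  have "has_bochner_integral lborel (\<lambda>y. exp (m + s\<^sup>2 / 2) * normal_density (m + s\<^sup>2) s y)
      (exp (m + s\<^sup>2 / 2) * 1)"
    using s by (intro has_bochner_integral_mult_right)
      (simp add: has_bochner_integral_iff integrable_normal_density integral_normal_density)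
  moreover have "exp y * (gbm_Gamma \<sigma> \<beta> t S u (exp y) * exp y)
      = exp (m + s\<^sup>2 / 2) * normal_density (m + s\<^sup>2) s y" for y
    using Gamma_lognormal[OF assms, of \<beta> y] exp_normal_density[OF s, of y m]
    by (simp add: m_def s_def)
  ultimately show "has_bochner_integral lborel (\<lambda>y. exp y * (gbm_Gamma \<sigma> \<beta> t S u (exp y) * exp y))
      (S * exp (\<beta> * (u - t)))"
    by (simp add: c)
qed

lemma Gamma_nonneg: "t \<le> u \<Longrightarrow> 0 \<le> gbm_Gamma \<sigma> \<beta> t S u z"
  by (simp add: gbm_Gamma_def indicator_def)

text \<open>
  The operator is defined with the completed measure, whereas measurability of parameter integrals
  and Fubini's theorem live on the Borel \<open>\<sigma>\<close>-algebra. This lemma moves between the two.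
\<close>

lemma lebesgue_integral_eq_lborel:
  fixes f f' :: "real \<Rightarrow> real"
  assumes f'[measurable]: "f' \<in> borel_measurable borel" and eq: "AE z in lborel. f z = f' z"
  shows "integrable lebesgue f \<longleftrightarrow> integrable lborel f'"
    and "integral\<^sup>L lebesgue f = integral\<^sup>L lborel f'"
proof -
  have eq': "AE z in lebesgue. f' z = f z"
    using AE_completion[OF eq] by eventually_elim simp
  have m': "f' \<in> borel_measurable lebesgue" by (intro measurable_completion) simp
  then have m: "f \<in> borel_measurable lebesgue" using eq' by (rule borel_measurable_AE)
  show "integrable lebesgue f \<longleftrightarrow> integrable lborel f'"
    using integrable_cong_AE[OF m' m eq'] by (simp add: integrable_completion)
  show "integral\<^sup>L lebesgue f = integral\<^sup>L lborel f'"
    using integral_cong_AE[OF m' m eq'] by (simp add: integral_completion)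
qed

lemma integral_abs_bound_AE:
  fixes f g :: "'a \<Rightarrow> real"
  assumes "integrable M f" "integrable M g" "AE x in M. \<bar>f x\<bar> \<le> g x"
  shows "\<bar>integral\<^sup>L M f\<bar> \<le> integral\<^sup>L M g"
  using integral_abs_bound[of M f] integral_mono_AE[OF integrable_abs[OF assms(1)] assms(2,3)] by linarith

text \<open>
  A function of growth \<open>1 + z\<close> is dominated by \<open>a (\<Gamma> + \<Gamma> z)\<close> after multiplication with the kernel,
  and the integral of the dominating function is known from \<open>Gamma_mass\<close> and \<open>Gamma_mean\<close>.
\<close>

lemma Gamma_integral_bound:
  assumes \<sigma>: "\<sigma> > 0" and tu: "t < u" and S: "S > 0"
    and f[measurable]: "f \<in> borel_measurable borel"
    and bound: "AE z in lborel. z > 0 \<longrightarrow> \<bar>f z\<bar> \<le> a * (1 + z)"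
  shows "integrable lborel (\<lambda>z. gbm_Gamma \<sigma> \<beta> t S u z * f z)"
    and "\<bar>LINT z|lborel. gbm_Gamma \<sigma> \<beta> t S u z * f z\<bar> \<le> a * (1 + S * exp (\<beta> * (u - t)))"
proof -
  let ?G = "gbm_Gamma \<sigma> \<beta> t S u"
  have "has_bochner_integral lborel (\<lambda>z. a * (?G z + ?G z * z)) (a * (1 + S * exp (\<beta> * (u - t))))"
    by (intro has_bochner_integral_mult_right has_bochner_integral_add Gamma_mass Gamma_mean \<sigma> tu S)
  then have int: "integrable lborel (\<lambda>z. a * (?G z + ?G z * z))"
    and val: "(LINT z|lborel. a * (?G z + ?G z * z)) = a * (1 + S * exp (\<beta> * (u - t)))"
    by (auto simp: has_bochner_integral_iff)
  have meas: "(\<lambda>z. ?G z * f z) \<in> borel_measurable lborel"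
    by (intro borel_measurable_times Gamma_measurable) simp_all
  have le: "AE z in lborel. norm (?G z * f z) \<le> a * (?G z + ?G z * z)"
    using bound
  proof eventually_elim
    case (elim z)
    show ?case
    proof (cases "z > 0")
      case True
      then have "?G z * \<bar>f z\<bar> \<le> ?G z * (a * (1 + z))"
        using elim tu by (intro mult_left_mono Gamma_nonneg) auto
      then show ?thesis using tu by (simp add: abs_mult Gamma_nonneg algebra_simps)
    next
      case False
      then show ?thesis by (simp add: gbm_Gamma_def)
    qed
  qed
  show i: "integrable lborel (\<lambda>z. ?G z * f z)"
    using int meas
  proof (rule Bochner_Integration.integrable_bound)
    show "AE z in lborel. norm (?G z * f z) \<le> norm (a * (?G z + ?G z * z))"
      using le by eventually_elim auto
  qed
  show "\<bar>LINT z|lborel. ?G z * f z\<bar> \<le> a * (1 + S * exp (\<beta> * (u - t)))"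
    using integral_abs_bound_AE[OF i int] le unfolding val by simp
qed

lemma Gamma_set_integral:
  assumes f[measurable]: "f' \<in> borel_measurable borel"
    and eq: "AE z in lborel. z > 0 \<longrightarrow> f z = f' z"
  shows "(LINT z:{0<..}|lebesgue. gbm_Gamma \<sigma> \<beta> t S u z * f z)
       = (LINT z|lborel. gbm_Gamma \<sigma> \<beta> t S u z * f' z)"
    and "set_integrable lebesgue {0<..} (\<lambda>z. gbm_Gamma \<sigma> \<beta> t S u z * f z)
       \<longleftrightarrow> integrable lborel (\<lambda>z. gbm_Gamma \<sigma> \<beta> t S u z * f' z)"
proof -
  have "AE z in lborel. indicator {0<..} z *\<^sub>R (gbm_Gamma \<sigma> \<beta> t S u z * f z) = gbm_Gamma \<sigma> \<beta> t S u z * f' z"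
    using eq by eventually_elim (auto simp: gbm_Gamma_def indicator_def)
  moreover have "(\<lambda>z. gbm_Gamma \<sigma> \<beta> t S u z * f' z) \<in> borel_measurable borel"
    by (intro borel_measurable_times Gamma_measurable) simp_all
  ultimately show "(LINT z:{0<..}|lebesgue. gbm_Gamma \<sigma> \<beta> t S u z * f z)
       = (LINT z|lborel. gbm_Gamma \<sigma> \<beta> t S u z * f' z)"
    "set_integrable lebesgue {0<..} (\<lambda>z. gbm_Gamma \<sigma> \<beta> t S u z * f z)
       \<longleftrightarrow> integrable lborel (\<lambda>z. gbm_Gamma \<sigma> \<beta> t S u z * f' z)"
    unfolding set_lebesgue_integral_def set_integrable_def
    by (simp_all only: lebesgue_integral_eq_lborel)
qed

text \<open>
  The constant is uniform in \<open>t\<close> and \<open>u\<close> and independent of the sign of \<open>\<beta>\<close>, so that the weight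
  \<open>1 + S\<close> is preserved by every iteration at the same cost.
\<close>

lemma Gamma_growth_le:
  fixes T :: real
  assumes "0 \<le> t" "t \<le> u" "u \<le> T" "S > 0" "a \<ge> 0"
  shows "a * (1 + S * exp (\<beta> * (u - t))) \<le> exp (\<bar>\<beta>\<bar> * T) * a * (1 + S)"
proof -
  have "\<beta> * (u - t) \<le> \<bar>\<beta>\<bar> * T"
    using assms by (intro mult_mono) auto
  then have 1: "exp (\<beta> * (u - t)) \<le> exp (\<bar>\<beta>\<bar> * T)" by simp
  have "1 \<le> exp (\<bar>\<beta>\<bar> * T)" using assms by simp
  moreover have "S * exp (\<beta> * (u - t)) \<le> S * exp (\<bar>\<beta>\<bar> * T)"
    using assms 1 by (intro mult_left_mono) auto
  ultimately have "1 + S * exp (\<beta> * (u - t)) \<le> exp (\<bar>\<beta>\<bar> * T) * (1 + S)"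
    unfolding distrib_left by (simp only: mult_1_right mult.commute[of S])
  from mult_left_mono[OF this \<open>a \<ge> 0\<close>] show ?thesis by (simp add: mult_ac)
qed

section \<open>Almost-everywhere calculus on the domain\<close>

text \<open>
  Joint measurability and Fubini's theorem concern Borel functions, so every Lebesgue measurable datum
  is exchanged for a Borel representative and, after the operation, exchanged back by
  \<open>borel_measurable_lebesgue_onI\<close>.
\<close>

lemma borel_measurable_lebesgue_onE:
  fixes f :: "'a::euclidean_space \<Rightarrow> real"
  assumes D: "D \<in> sets borel" and f: "f \<in> borel_measurable (lebesgue_on D)"
  obtains f' where "f' \<in> borel_measurable borel" "AE p in lborel. p \<in> D \<longrightarrow> f p = f' p"
proof -
  have "(\<lambda>p. indicator D p *\<^sub>R f p) \<in> borel_measurable lebesgue"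
    using f by (subst (asm) borel_measurable_restrict_space_iff) (use D in simp_all)
  from completion_ex_borel_measurable_real[OF this]
  obtain f' where f': "f' \<in> borel_measurable lborel" "AE p in lborel. indicator D p *\<^sub>R f p = f' p"
    by blast
  from f'(2) have "AE p in lborel. p \<in> D \<longrightarrow> f p = f' p"
    by eventually_elim (auto simp: indicator_def)
  with f'(1) show ?thesis by (intro that[of f']) simp_all
qed

lemma borel_measurable_lebesgue_onI:
  fixes f :: "'a::euclidean_space \<Rightarrow> real"
  assumes D: "D \<in> sets borel" and f'[measurable]: "f' \<in> borel_measurable borel"
    and eq: "AE p in lborel. p \<in> D \<longrightarrow> f p = f' p"
  shows "f \<in> borel_measurable (lebesgue_on D)"
proof -
  have "(\<lambda>p. indicator D p *\<^sub>R f' p) \<in> borel_measurable borel" using D by measurable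
  then have "(\<lambda>p. indicator D p *\<^sub>R f' p) \<in> borel_measurable lebesgue"
    by (intro measurable_completion) simp
  moreover have "AE p in lebesgue. indicator D p *\<^sub>R f' p = indicator D p *\<^sub>R f p"
    using AE_completion[OF eq] by eventually_elim (auto simp: indicator_def)
  ultimately have "(\<lambda>p. indicator D p *\<^sub>R f p) \<in> borel_measurable lebesgue"
    by (rule borel_measurable_AE)
  then show ?thesis
    by (subst borel_measurable_restrict_space_iff) (use D in simp_all)
qed

text \<open>
  Almost-everywhere properties hold on a dense set, because nonempty open sets are not negligible.
\<close>

lemma AE_lborel_meets_open:
  fixes U :: "'a::euclidean_space set"
  assumes ae: "AE x in lborel. P x" and U: "open U" "U \<noteq> {}"
  shows "\<exists>x\<in>U. P x"
proof (rule ccontr)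
  assume "\<not> ?thesis"
  with ae have "AE x in lborel. x \<notin> U" by (auto elim: eventually_mono)
  then have "AE x in lebesgue. x \<notin> U" by (rule AE_completion)
  then have "negligible U" using negligible_iff_null_sets completion.AE_iff_null_sets[of "\<lambda>x. x \<notin> U" lborel]
    by (auto simp: space_completion)
  with open_not_negligible[OF U] show False by contradiction
qed

text \<open>
  By Fubini, the product of a null set of times with the space axis is null.
\<close>

lemma AE_lborel_fst:
  fixes P :: "real \<Rightarrow> bool"
  assumes "AE t in lborel. P t"
  shows "AE p in (lborel :: (real \<times> real) measure). P (fst p)"
proof -
  from assms obtain N where N: "N \<in> null_sets lborel" "{t. \<not> P t} \<subseteq> N"
    unfolding eventually_ae_filter by auto
  have "AE t in lborel. AE z in (lborel::real measure). fst (t, z) \<notin> N"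
    using AE_not_in[OF N(1)] by eventually_elim simp
  then have "AE p in lborel \<Otimes>\<^sub>M (lborel::real measure). fst p \<notin> N"
    using N(1) by (intro lborel_pair.AE_pair_measure) (measurable, auto simp: null_sets_def)
  then show ?thesis unfolding lborel_prod using N(2) by (auto elim: eventually_mono)
qed

lemma dom_borel: "({0..T} \<times> {0<..} :: (real \<times> real) set) \<in> sets borel"
proof -
  have "({0..T} \<times> {0<..} :: (real \<times> real) set) \<in> sets (borel \<Otimes>\<^sub>M borel)" by measurable
  then show ?thesis by (simp only: borel_prod)
qed

lemma AE_X_meas_iff: "(AE p in X_meas T. P p) \<longleftrightarrow> (AE p in lborel. p \<in> {0..T} \<times> {0<..} \<longrightarrow> P p)"
  using dom_borel[of T] unfolding X_meas_def
  by (subst AE_restrict_space_iff) (auto simp: AE_completion_iff)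

lemma AE_X_meas_sections:
  assumes "AE p in X_meas T. P p"
  shows "AE u in lborel. u \<in> {0..T} \<longrightarrow> (AE z in lborel. z > 0 \<longrightarrow> P (u, z))"
proof -
  have "AE p in lborel \<Otimes>\<^sub>M lborel. p \<in> {0..T} \<times> {0<..} \<longrightarrow> P p"
    using assms unfolding lborel_prod AE_X_meas_iff .
  from lborel_pair.AE_pair[OF this] show ?thesis
    by eventually_elim (auto elim: eventually_mono)
qed

lemma AE_X_measI:
  assumes "\<And>t S. t \<in> {0..T} \<Longrightarrow> S > 0 \<Longrightarrow> P (t, S)"
  shows "AE p in X_meas T. P p"
  unfolding AE_X_meas_iff using assms by auto

lemma AE_X_meas_dom: "AE p in X_meas T. fst p \<in> {0..T} \<and> snd p > 0"
  by (rule AE_X_measI) auto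

lemma snd_measurable_X_meas: "snd \<in> borel_measurable (X_meas T)"
  unfolding X_meas_def
  by (intro measurable_restrict_space1 measurable_completion)
    (auto intro!: borel_measurable_continuous_onI continuous_intros)

lemma rep_esssup_le:
  assumes x: "x \<in> borel_measurable (X_meas T)"
    and bound: "AE p in X_meas T. \<bar>x p\<bar> \<le> M * (1 + snd p)"
  shows "rep_esssup T x \<le> ereal M"
  unfolding rep_esssup_def
proof (rule esssup_I)
  have "(\<lambda>p. ereal \<bar>x p / (1 + snd p)\<bar>) \<in> borel_measurable (X_meas T)"
    by (intro borel_measurable_ereal borel_measurable_abs borel_measurable_divide
        borel_measurable_add borel_measurable_const x snd_measurable_X_meas)
  then show "(\<lambda>(t, S). ereal \<bar>x (t, S) / (1 + S)\<bar>) \<in> borel_measurable (X_meas T)"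
    by (simp only: case_prod_unfold prod.collapse)
  show "AE p in X_meas T. (case p of (t, S) \<Rightarrow> ereal \<bar>x (t, S) / (1 + S)\<bar>) \<le> ereal M"
    using bound AE_X_meas_dom
    by eventually_elim (auto simp: case_prod_unfold abs_divide divide_le_eq)
qed

text \<open>
  The essential supremum is attained as a bound. It cannot be \<open>\<infinity>\<close> here, and if it is \<open>-\<infinity>\<close>
  then the measure vanishes and any bound holds.
\<close>

lemma rep_esssup_bound:
  assumes "x \<in> X_fun T"
  shows "AE p in X_meas T. \<bar>x p\<bar> \<le> real_of_ereal (rep_esssup T x) * (1 + snd p)"
proof -
  have fin: "rep_esssup T x < \<infinity>" using assms by (simp add: X_fun_def)
  have "AE p in X_meas T. (case p of (t, S) \<Rightarrow> ereal \<bar>x (t, S) / (1 + S)\<bar>) \<le> rep_esssup T x"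
    unfolding rep_esssup_def by (rule esssup_AE)
  then show ?thesis using AE_X_meas_dom
  proof eventually_elim
    case (elim p)
    with fin show ?case
      by (cases "rep_esssup T x") (auto simp: case_prod_unfold abs_divide divide_le_eq)
  qed
qed

lemma X_funI:
  assumes "x \<in> borel_measurable (X_meas T)" "AE p in X_meas T. \<bar>x p\<bar> \<le> M * (1 + snd p)"
  shows "x \<in> X_fun T"
  using assms rep_esssup_le[OF assms] by (auto simp: X_fun_def)

lemma X_funE:
  assumes "x \<in> X_fun T"
  obtains M where "M \<ge> 0" "AE p in X_meas T. \<bar>x p\<bar> \<le> M * (1 + snd p)"
proof
  show "0 \<le> \<bar>real_of_ereal (rep_esssup T x)\<bar>" by (rule abs_ge_zero)
  show "AE p in X_meas T. \<bar>x p\<bar> \<le> \<bar>real_of_ereal (rep_esssup T x)\<bar> * (1 + snd p)"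
    using rep_esssup_bound[OF assms] AE_X_meas_dom
  proof eventually_elim
    case (elim p)
    then show ?case
      by (smt (verit, best) mult_right_mono)
  qed
qed

lemma X_fun_measurable: "x \<in> X_fun T \<Longrightarrow> x \<in> borel_measurable (X_meas T)"
  by (simp add: X_fun_def)

section \<open>Superposition with a Lipschitz nonlinearity\<close>

text \<open>
  By Fubini, for almost every \<open>q = (S, f)\<close> the function \<open>F\<close> agrees at \<open>(t, q)\<close>, for almost every \<open>t\<close>,
  with a fixed Borel function \<open>H\<close>. Countably many such \<open>q\<close> form a dense set \<open>D\<close>, and
  the exceptional sets of times for \<open>q \<in> D\<close> unite to a null set. For all other \<open>t\<close>, an
  \<open>L\<close>-Lipschitz function is the infimal convolution \<open>inf (H(t, q) + L |\<cdot> - q|)\<close> over \<open>q \<in> D\<close> of its values on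
  \<open>D\<close>, and this countable infimum is jointly Borel.
\<close>

lemma lipschitz_borel_modification:
  fixes F :: "real \<Rightarrow> real \<Rightarrow> real \<Rightarrow> real"
  assumes F_meas: "(\<lambda>(t, S, f). F t S f) \<in> borel_measurable (lebesgue_on ({0..T} \<times> {0..} \<times> UNIV))"
    and lip: "\<And>t S S' f h. t \<in> {0..T} \<Longrightarrow> S \<ge> 0 \<Longrightarrow> S' \<ge> 0 \<Longrightarrow>
      \<bar>F t S f - F t S' h\<bar> \<le> L * (\<bar>S - S'\<bar> + \<bar>f - h\<bar>)"
    and L: "L > 0"
  obtains F' where "F' \<in> borel_measurable borel"
    "AE t in lborel. t \<in> {0..T} \<longrightarrow> (\<forall>S\<ge>0. \<forall>f. F t S f = F' (t, S, f))"
proof -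
  let ?D = "{0..T} \<times> {0..} \<times> (UNIV::real set) :: (real \<times> real \<times> real) set"
  have "?D \<in> sets borel" by (intro borel_closed closed_Times) auto
  then obtain H where H[measurable]: "H \<in> borel_measurable borel"
    and eq: "AE p in lborel. p \<in> ?D \<longrightarrow> (case p of (t, S, f) \<Rightarrow> F t S f) = H p"
    using F_meas by (rule borel_measurable_lebesgue_onE)
  obtain N where N: "N \<in> null_sets lborel"
    and N': "{p \<in> space lborel. \<not> (p \<in> ?D \<longrightarrow> (case p of (t, S, f) \<Rightarrow> F t S f) = H p)} \<subseteq> N"
    using eq unfolding eventually_ae_filter by (rule bexE)
  have "AE p in lborel \<Otimes>\<^sub>M lborel. p \<notin> N"
    unfolding lborel_prod by (rule AE_not_in[OF N])
  then have tq: "AE t in lborel. AE q in lborel. (t, q) \<notin> N"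
    by (rule lborel_pair.AE_pair)
  have meas: "{p \<in> space (lborel \<Otimes>\<^sub>M lborel). (fst p, snd p) \<notin> N} \<in> sets (lborel \<Otimes>\<^sub>M lborel)"
    unfolding lborel_prod using N by (auto simp: null_sets_def)
  have good: "AE q in lborel. AE t in lborel. (t, q) \<notin> N"
    using lborel_pair.AE_commute[where P = "\<lambda>t q. (t, q) \<notin> N", OF meas] tq by blast
  \<comment> \<open>The restriction keeps \<open>D\<close> inside the domain of \<open>F\<close>; points with \<open>S = 0\<close> are limits of points in \<open>D\<close>.\<close>
  define Q where "Q = {q \<in> {0<..} \<times> UNIV. AE t in lborel. (t, q) \<notin> N}"
  obtain D where D: "countable D" "D \<subseteq> Q" "Q \<subseteq> closure D"
    using separable by blast
  have dense: "\<exists>q\<in>D. \<bar>S - fst q\<bar> + \<bar>f - snd q\<bar> < \<epsilon>" if "S \<ge> 0" "\<epsilon> > 0" for S f \<epsilon> :: real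
  proof -
    let ?U = "{S<..<S + \<epsilon> / 4} \<times> {f - \<epsilon> / 4<..<f + \<epsilon> / 4}"
    have "open ?U" "?U \<noteq> {}" using \<open>\<epsilon> > 0\<close> by (auto intro!: open_Times)
    from AE_lborel_meets_open[OF good this] obtain q where q: "q \<in> ?U" "q \<in> Q"
      using \<open>S \<ge> 0\<close> unfolding Q_def by fastforce
    then obtain d where d: "d \<in> D" "dist d q < \<epsilon> / 4"
      using D(3) \<open>\<epsilon> > 0\<close> closure_approachable by (metis subsetD divide_pos_pos zero_less_numeral)
    have "\<bar>fst d - fst q\<bar> < \<epsilon> / 4" "\<bar>snd d - snd q\<bar> < \<epsilon> / 4"
      using d(2) dist_fst_le[of d q] dist_snd_le[of d q] by (simp_all add: dist_real_def)
    moreover have "fst q - S < \<epsilon> / 4" "S < fst q" "f - snd q < \<epsilon> / 4" "snd q - f < \<epsilon> / 4"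
      using q(1) unfolding mem_Times_iff greaterThanLessThan_iff by auto
    ultimately show ?thesis using d(1) by (intro bexI[of _ d]) linarith+
  qed
  \<comment> \<open>The infimum is taken in the extended reals, as it may be \<open>-\<infinity>\<close> at the exceptional times.\<close>
  define F' where "F' p = real_of_ereal (INF q\<in>D. ereal (H (fst p, q)
      + L * (\<bar>fst (snd p) - fst q\<bar> + \<bar>snd (snd p) - snd q\<bar>)))" for p
  have "(\<lambda>p. ereal (H (fst p, q) + L * (\<bar>fst (snd p) - fst q\<bar> + \<bar>snd (snd p) - snd q\<bar>)))
      \<in> borel_measurable borel" for q
    by (intro borel_measurable_ereal borel_measurable_add measurable_compose[OF _ H]
        borel_measurable_continuous_onI continuous_intros)
  then have "F' \<in> borel_measurable borel"
    unfolding F'_def using D(1) by (intro borel_measurable_real_of_ereal borel_measurable_INF)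
  moreover have "AE t in lborel. \<forall>q\<in>D. (t, q) \<notin> N"
    using D(1,2) unfolding AE_ball_countable[OF D(1)] by (auto simp: Q_def)
  then have "AE t in lborel. t \<in> {0..T} \<longrightarrow> (\<forall>S\<ge>0. \<forall>f. F t S f = F' (t, S, f))"
  proof eventually_elim
    case (elim t)
    have "F t S f = F' (t, S, f)" if t: "t \<in> {0..T}" and S: "S \<ge> 0" for S f
    proof -
      have q0: "fst q \<ge> 0" if "q \<in> D" for q
        using that D(2) by (auto simp: Q_def mem_Times_iff)
      have HF: "H (t, q) = F t (fst q) (snd q)" if "q \<in> D" for q
        using that elim t q0[OF that] subsetD[OF N', of "(t, q)"]
        by (intro ccontr[of "_ = _"]) (auto simp: case_prod_unfold mem_Times_iff)
      have "(INF q\<in>D. ereal (H (t, q) + L * (\<bar>S - fst q\<bar> + \<bar>f - snd q\<bar>))) = ereal (F t S f)"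
      proof (rule INF_eqI)
        fix q assume q: "q \<in> D"
        show "ereal (F t S f) \<le> ereal (H (t, q) + L * (\<bar>S - fst q\<bar> + \<bar>f - snd q\<bar>))"
          using lip[OF t S q0[OF q], of f "snd q"] by (simp add: HF[OF q])
      next
        fix y assume y: "\<And>q. q \<in> D \<Longrightarrow> y \<le> ereal (H (t, q) + L * (\<bar>S - fst q\<bar> + \<bar>f - snd q\<bar>))"
        show "y \<le> ereal (F t S f)"
        proof (rule ereal_le_epsilon2)
          fix e :: real assume e: "0 < e"
          have "e / (2 * L) > 0" using e L by simp
          from dense[OF S this] obtain q where q: "q \<in> D" "\<bar>S - fst q\<bar> + \<bar>f - snd q\<bar> < e / (2 * L)"
            by blast
          have "L * (\<bar>S - fst q\<bar> + \<bar>f - snd q\<bar>) < e / 2"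
            using q(2) L by (simp add: field_simps)
          with lip[OF t S q0[OF q(1)], of f "snd q"]
          have "H (t, q) + L * (\<bar>S - fst q\<bar> + \<bar>f - snd q\<bar>) \<le> F t S f + e"
            by (simp add: HF[OF q(1)])
          with y[OF q(1)] show "y \<le> ereal (F t S f) + ereal e"
            by (metis ereal_less_eq(3) order_trans plus_ereal.simps(1))
        qed
      qed
      then show ?thesis by (simp add: F'_def)
    qed
    then show ?case by blast
  qed
  ultimately show ?thesis using that by blast
qed

text \<open>
  Composing a Borel representative of \<open>F\<close> with one of \<open>x\<close> is harmless since the exceptional set of the
  former is a set of times only.
\<close>

lemma superposition_measurable:
  fixes F :: "real \<Rightarrow> real \<Rightarrow> real \<Rightarrow> real"
  assumes F_meas: "(\<lambda>(t, S, f). F t S f) \<in> borel_measurable (lebesgue_on ({0..T} \<times> {0..} \<times> UNIV))"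
    and lip: "\<And>t S S' f h. t \<in> {0..T} \<Longrightarrow> S \<ge> 0 \<Longrightarrow> S' \<ge> 0 \<Longrightarrow>
      \<bar>F t S f - F t S' h\<bar> \<le> L * (\<bar>S - S'\<bar> + \<bar>f - h\<bar>)"
    and L: "L > 0"
    and x: "x \<in> borel_measurable (X_meas T)"
  shows "(\<lambda>(t, S). F t S (x (t, S))) \<in> borel_measurable (X_meas T)"
proof -
  obtain F' where [measurable]: "F' \<in> borel_measurable borel"
    and F': "AE t in lborel. t \<in> {0..T} \<longrightarrow> (\<forall>S\<ge>0. \<forall>f. F t S f = F' (t, S, f))"
    by (rule lipschitz_borel_modification[OF F_meas lip L])
  obtain x' where [measurable]: "x' \<in> borel_measurable borel"
    and x': "AE p in lborel. p \<in> {0..T} \<times> {0<..} \<longrightarrow> x p = x' p"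
    using x unfolding X_meas_def by (rule borel_measurable_lebesgue_onE[OF dom_borel])
  have "(\<lambda>p. F' (fst p, snd p, x' p)) \<in> borel_measurable borel"
    unfolding borel_prod[symmetric] by (measurable) (auto simp: borel_prod)
  moreover have "AE p in lborel. p \<in> {0..T} \<times> {0<..} \<longrightarrow>
      (case p of (t, S) \<Rightarrow> F t S (x (t, S))) = F' (fst p, snd p, x' p)"
    using x' AE_lborel_fst[OF F'] by eventually_elim (auto simp: case_prod_unfold mem_Times_iff)
  ultimately show ?thesis
    unfolding X_meas_def by (rule borel_measurable_lebesgue_onI[OF dom_borel])
qed

section \<open>The Duhamel integral\<close>

text \<open>
  By Duhamel's principle, the mild solution \<open>v\<close> of \<open>A v = - h\<close> with \<open>v(T, \<cdot>) = 0\<close>, where \<open>A\<close> is the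
  differential operator with fundamental solution \<open>\<Gamma>\<close>.
\<close>

definition duhamel :: "real \<Rightarrow> real \<Rightarrow> real \<Rightarrow> (real \<times> real \<Rightarrow> real) \<Rightarrow> real \<times> real \<Rightarrow> real" where
  "duhamel T \<sigma> \<beta> h = (\<lambda>(t, S).
     LINT u:{t..T}|lebesgue. LINT z:{0<..}|lebesgue. gbm_Gamma \<sigma> \<beta> t S u z * h (u, z))"

lemma inner_Gamma_measurable:
  assumes h': "h' \<in> borel_measurable (borel :: (real \<times> real) measure)"
    and t: "t \<in> borel_measurable M" and S: "S \<in> borel_measurable M" and u: "u \<in> borel_measurable M"
  shows "(\<lambda>w. LINT z|lborel. gbm_Gamma \<sigma> \<beta> (t w) (S w) (u w) z * h' (u w, z)) \<in> borel_measurable M"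
proof -
  note [measurable] = t S u
  have h2[measurable]: "h' \<in> borel_measurable (borel \<Otimes>\<^sub>M borel)"
    using h' by (simp only: borel_prod)
  show ?thesis
    by (intro lborel.borel_measurable_lebesgue_integral, unfold case_prod_unfold)
      (intro borel_measurable_times Gamma_measurable; measurable)
qed

text \<open>
  The indicator of the moving interval \<open>{t..T}\<close> is jointly measurable when written as a pair of
  inequalities.
\<close>

lemma iterated_Gamma_measurable:
  assumes h': "h' \<in> borel_measurable (borel :: (real \<times> real) measure)"
  shows "(\<lambda>p. LINT u|lborel. indicator {fst p..T} u *
            (LINT z|lborel. gbm_Gamma \<sigma> \<beta> (fst p) (snd p) u z * h' (u, z))) \<in> borel_measurable borel"
proof -
  have inner: "(\<lambda>w. LINT z|lborel. gbm_Gamma \<sigma> \<beta> (fst (fst w)) (snd (fst w)) (snd w) z * h' (snd w, z))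
      \<in> borel_measurable (((borel :: real measure) \<Otimes>\<^sub>M (borel :: real measure)) \<Otimes>\<^sub>M lborel)"
    by (rule inner_Gamma_measurable[OF h']) measurable
  have ind: "(\<lambda>w. indicator {fst (fst w)..T} (snd w) :: real)
      \<in> borel_measurable (((borel :: real measure) \<Otimes>\<^sub>M (borel :: real measure)) \<Otimes>\<^sub>M lborel)"
  proof -
    have "(\<lambda>w :: (real \<times> real) \<times> real. indicator {fst (fst w)..T} (snd w) :: real)
        = (\<lambda>w. if fst (fst w) \<le> snd w \<and> snd w \<le> T then 1 else 0)"
      by (auto simp: indicator_def)
    then show ?thesis by (simp only:) measurable
  qed
  show ?thesis
    unfolding borel_prod[symmetric]
    by (intro lborel.borel_measurable_lebesgue_integral, unfold case_prod_unfold)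
      (rule borel_measurable_times[OF ind inner])
qed

text \<open>
  All properties of the Duhamel integral come from one observation: for almost every time \<open>u\<close> the
  slice \<open>h(u, \<cdot>)\<close> equals almost everywhere a Borel function that obeys the growth bound, so that the
  inner integral agrees for almost every \<open>u\<close> with a Borel function of \<open>u\<close> and is bounded by a multiple
  of \<open>\<phi> u\<close>. Keeping a
  function \<open>\<phi>\<close> of time, and not a constant, is what produces the factorials later.
\<close>

lemma duhamel_estimates:
  fixes T :: real
  assumes \<sigma>: "\<sigma> > 0"
    and h: "h \<in> borel_measurable (X_meas T)"
    and bound: "AE p in X_meas T. \<bar>h p\<bar> \<le> \<phi> (fst p) * (1 + snd p)"
    and \<phi>: "\<And>u. u \<in> {0..T} \<Longrightarrow> 0 \<le> \<phi> u" "set_integrable lborel {0..T} \<phi>"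
  shows duhamel_inner_integrable: "\<And>t S. t \<in> {0..T} \<Longrightarrow> S > 0 \<Longrightarrow>
      AE u in lebesgue_on {t..T}. set_integrable lebesgue {0<..} (\<lambda>z. gbm_Gamma \<sigma> \<beta> t S u z * h (u, z))"
    and duhamel_outer_integrable: "\<And>t S. t \<in> {0..T} \<Longrightarrow> S > 0 \<Longrightarrow>
      set_integrable lebesgue {t..T} (\<lambda>u. LINT z:{0<..}|lebesgue. gbm_Gamma \<sigma> \<beta> t S u z * h (u, z))"
    and duhamel_measurable: "duhamel T \<sigma> \<beta> h \<in> borel_measurable (X_meas T)"
    and duhamel_bound: "\<And>t S. t \<in> {0..T} \<Longrightarrow> S > 0 \<Longrightarrow>
      \<bar>duhamel T \<sigma> \<beta> h (t, S)\<bar> \<le> exp (\<bar>\<beta>\<bar> * T) * (LINT u:{t..T}|lborel. \<phi> u) * (1 + S)"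
proof -
  obtain h' where h'[measurable]: "h' \<in> borel_measurable borel"
    and hh': "AE p in lborel. p \<in> {0..T} \<times> {0<..} \<longrightarrow> h p = h' p"
    using h unfolding X_meas_def by (rule borel_measurable_lebesgue_onE[OF dom_borel])
  let ?\<Gamma> = "gbm_Gamma \<sigma> \<beta>"
  let ?I = "\<lambda>t S u. LINT z|lborel. ?\<Gamma> t S u z * h' (u, z)"
  have h'u[measurable]: "(\<lambda>z. h' (u, z)) \<in> borel_measurable borel" for u
    by (intro measurable_compose[OF _ h'] borel_measurable_continuous_onI continuous_intros)
  have "AE p in X_meas T. h p = h' p \<and> \<bar>h p\<bar> \<le> \<phi> (fst p) * (1 + snd p)"
    using bound hh'[folded AE_X_meas_iff] by eventually_elim simp
  from AE_X_meas_sections[OF this]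
  have sec: "AE u in lborel. u \<in> {0..T} \<longrightarrow>
      (AE z in lborel. z > 0 \<longrightarrow> h (u, z) = h' (u, z)) \<and> (AE z in lborel. z > 0 \<longrightarrow> \<bar>h' (u, z)\<bar> \<le> \<phi> u * (1 + z))"
    by eventually_elim (auto elim: eventually_mono)
  have inner: "AE u in lborel. u \<in> {t..T} \<longrightarrow>
        set_integrable lebesgue {0<..} (\<lambda>z. ?\<Gamma> t S u z * h (u, z))
      \<and> (LINT z:{0<..}|lebesgue. ?\<Gamma> t S u z * h (u, z)) = ?I t S u
      \<and> \<bar>?I t S u\<bar> \<le> exp (\<bar>\<beta>\<bar> * T) * \<phi> u * (1 + S)" if t: "t \<in> {0..T}" and S: "S > 0" for t S
    \<comment> \<open>The kernel degenerates at \<open>u = t\<close>, a null set of times.\<close>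
    using sec AE_lborel_singleton[of t]
  proof eventually_elim
    case (elim u)
    show ?case
    proof (intro impI)
      assume u: "u \<in> {t..T}"
      then have tu: "t < u" and u': "u \<in> {0..T}" using elim t by auto
      note e = elim(1)[rule_format, OF u']
      note b = Gamma_integral_bound[OF \<sigma> tu S h'u conjunct2[OF e], of \<beta>]
      note s = Gamma_set_integral[OF h'u conjunct1[OF e], of \<sigma> \<beta> t S u]
      have "\<bar>?I t S u\<bar> \<le> exp (\<bar>\<beta>\<bar> * T) * \<phi> u * (1 + S)"
        using b(2) Gamma_growth_le[of t u T S "\<phi> u" \<beta>] t u S \<phi>(1)[OF u'] by simp
      then show "set_integrable lebesgue {0<..} (\<lambda>z. ?\<Gamma> t S u z * h (u, z))
          \<and> (LINT z:{0<..}|lebesgue. ?\<Gamma> t S u z * h (u, z)) = ?I t S u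
          \<and> \<bar>?I t S u\<bar> \<le> exp (\<bar>\<beta>\<bar> * T) * \<phi> u * (1 + S)"
        using s b(1) by simp
    qed
  qed
  have I_meas: "(\<lambda>u. indicator {t..T} u * ?I t S u) \<in> borel_measurable borel" for t S
    by (intro borel_measurable_times inner_Gamma_measurable[OF h']) simp_all
  have outer_eq: "AE u in lborel. indicator {t..T} u *\<^sub>R (LINT z:{0<..}|lebesgue. ?\<Gamma> t S u z * h (u, z))
      = indicator {t..T} u * ?I t S u" if "t \<in> {0..T}" "S > 0" for t S
    using inner[OF that] by eventually_elim (auto simp: indicator_def)
  have \<phi>_int: "integrable lborel (\<lambda>u. exp (\<bar>\<beta>\<bar> * T) * (indicator {t..T} u * \<phi> u) * (1 + S))"
    if "t \<in> {0..T}" for t S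
  proof -
    have "set_integrable lborel {t..T} \<phi>"
      using \<phi>(2) by (rule set_integrable_subset) (use that in auto)
    then show ?thesis
      by (intro integrable_mult_left integrable_mult_right) (simp add: set_integrable_def)
  qed
  have le: "AE u in lborel. norm (indicator {t..T} u * ?I t S u)
      \<le> exp (\<bar>\<beta>\<bar> * T) * (indicator {t..T} u * \<phi> u) * (1 + S)" if "t \<in> {0..T}" "S > 0" for t S
    using inner[OF that] by eventually_elim (auto simp: indicator_def)
  have I_int: "integrable lborel (\<lambda>u. indicator {t..T} u * ?I t S u)" if "t \<in> {0..T}" "S > 0" for t S
    using \<phi>_int[OF that(1), of S]
  proof (rule Bochner_Integration.integrable_bound)
    show "(\<lambda>u. indicator {t..T} u * ?I t S u) \<in> borel_measurable lborel" using I_meas by simp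
    show "AE u in lborel. norm (indicator {t..T} u * ?I t S u)
        \<le> norm (exp (\<bar>\<beta>\<bar> * T) * (indicator {t..T} u * \<phi> u) * (1 + S))"
      using le[OF that] by eventually_elim auto
  qed
  have eq: "duhamel T \<sigma> \<beta> h (t, S) = (LINT u|lborel. indicator {t..T} u * ?I t S u)"
    if "t \<in> {0..T}" "S > 0" for t S
    unfolding duhamel_def set_lebesgue_integral_def[of _ "{t..T}"] prod.case
    by (rule lebesgue_integral_eq_lborel(2)[OF I_meas outer_eq[OF that]])
  show "AE u in lebesgue_on {t..T}. set_integrable lebesgue {0<..} (\<lambda>z. ?\<Gamma> t S u z * h (u, z))"
    if "t \<in> {0..T}" "S > 0" for t S
    using AE_completion[OF inner[OF that]]
    by (subst AE_restrict_space_iff) (auto elim: eventually_mono)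
  show "set_integrable lebesgue {t..T} (\<lambda>u. LINT z:{0<..}|lebesgue. ?\<Gamma> t S u z * h (u, z))"
    if "t \<in> {0..T}" "S > 0" for t S
    unfolding set_integrable_def[of _ "{t..T}"]
    using lebesgue_integral_eq_lborel(1)[OF I_meas outer_eq[OF that]] I_int[OF that] by simp
  show "duhamel T \<sigma> \<beta> h \<in> borel_measurable (X_meas T)"
    unfolding X_meas_def
  proof (rule borel_measurable_lebesgue_onI[OF dom_borel iterated_Gamma_measurable[OF h', of T \<sigma> \<beta>]])
    show "AE p in lborel. p \<in> {0..T} \<times> {0<..} \<longrightarrow> duhamel T \<sigma> \<beta> h p
        = (LINT u|lborel. indicator {fst p..T} u * ?I (fst p) (snd p) u)"
      using eq by (auto simp: mem_Times_iff)
  qed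
  show "\<bar>duhamel T \<sigma> \<beta> h (t, S)\<bar> \<le> exp (\<bar>\<beta>\<bar> * T) * (LINT u:{t..T}|lborel. \<phi> u) * (1 + S)"
    if "t \<in> {0..T}" "S > 0" for t S
  proof -
    have "\<bar>duhamel T \<sigma> \<beta> h (t, S)\<bar> \<le> (LINT u|lborel. exp (\<bar>\<beta>\<bar> * T) * (indicator {t..T} u * \<phi> u) * (1 + S))"
      unfolding eq[OF that]
      by (rule integral_abs_bound_AE[OF I_int[OF that] \<phi>_int[OF that(1)]])
        (use le[OF that] in simp)
    also have "\<dots> = exp (\<bar>\<beta>\<bar> * T) * (LINT u:{t..T}|lborel. \<phi> u) * (1 + S)"
      by (simp add: set_lebesgue_integral_def)
    finally show ?thesis .
  qed
qed

lemma const_integrable: "set_integrable lborel {0..T::real} (\<lambda>_. M :: real)"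
  by (intro borel_integrable_atLeastAtMost' continuous_intros)

text \<open>
  Linearity holds pointwise because all integrals involved converge.
\<close>

lemma duhamel_diff:
  assumes \<sigma>: "\<sigma> > 0" and h: "h1 \<in> X_fun T" "h2 \<in> X_fun T"
    and t: "t \<in> {0..T}" and S: "S > 0"
  shows "duhamel T \<sigma> \<beta> h1 (t, S) - duhamel T \<sigma> \<beta> h2 (t, S)
       = duhamel T \<sigma> \<beta> (\<lambda>p. h1 p - h2 p) (t, S)"
proof -
  have props: "AE u in lebesgue. u \<in> {t..T} \<longrightarrow> set_integrable lebesgue {0<..} (\<lambda>z. gbm_Gamma \<sigma> \<beta> t S u z * h (u, z))"
     "set_integrable lebesgue {t..T} (\<lambda>u. LINT z:{0<..}|lebesgue. gbm_Gamma \<sigma> \<beta> t S u z * h (u, z))"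
    if h: "h \<in> X_fun T" for h
  proof -
    obtain M where M: "M \<ge> 0" "AE p in X_meas T. \<bar>h p\<bar> \<le> M * (1 + snd p)"
      using h by (rule X_funE)
    note p = \<sigma> X_fun_measurable[OF h] M(2) M(1) const_integrable
    have "AE u in lebesgue_on {t..T}. set_integrable lebesgue {0<..} (\<lambda>z. gbm_Gamma \<sigma> \<beta> t S u z * h (u, z))"
      by (rule duhamel_inner_integrable[where \<phi> = "\<lambda>_. M", OF p t S])
    then show "AE u in lebesgue. u \<in> {t..T} \<longrightarrow> set_integrable lebesgue {0<..} (\<lambda>z. gbm_Gamma \<sigma> \<beta> t S u z * h (u, z))"
      by (subst (asm) AE_restrict_space_iff) auto
    show "set_integrable lebesgue {t..T} (\<lambda>u. LINT z:{0<..}|lebesgue. gbm_Gamma \<sigma> \<beta> t S u z * h (u, z))"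
      by (rule duhamel_outer_integrable[where \<phi> = "\<lambda>_. M", OF p t S])
  qed
  let ?i = "\<lambda>h u. LINT z:{0<..}|lebesgue. gbm_Gamma \<sigma> \<beta> t S u z * h (u, z)"
  have h12: "(\<lambda>p. h1 p - h2 p) \<in> X_fun T" using h by (rule X_fun_diff)
  have eq: "AE u in lebesgue. indicator {t..T} u *\<^sub>R (?i h1 u - ?i h2 u)
      = indicator {t..T} u *\<^sub>R ?i (\<lambda>p. h1 p - h2 p) u"
    using props(1)[OF h(1)] props(1)[OF h(2)]
  proof eventually_elim
    case (elim u)
    show ?case
    proof (cases "u \<in> {t..T}")
      case True
      with elim have "?i h1 u - ?i h2 u
          = (LINT z:{0<..}|lebesgue. gbm_Gamma \<sigma> \<beta> t S u z * h1 (u, z) - gbm_Gamma \<sigma> \<beta> t S u z * h2 (u, z))"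
        by (intro set_integral_diff(2)[symmetric]) auto
      then show ?thesis by (simp add: right_diff_distrib)
    qed simp
  qed
  have d: "set_integrable lebesgue {t..T} (\<lambda>u. ?i h1 u - ?i h2 u)"
    by (intro set_integral_diff(1) props h)
  have "duhamel T \<sigma> \<beta> h1 (t, S) - duhamel T \<sigma> \<beta> h2 (t, S)
      = (LINT u:{t..T}|lebesgue. ?i h1 u - ?i h2 u)"
    unfolding duhamel_def prod.case
    by (intro set_integral_diff(2)[symmetric] props h)
  also have "\<dots> = (LINT u:{t..T}|lebesgue. ?i (\<lambda>p. h1 p - h2 p) u)"
    unfolding set_lebesgue_integral_def[of _ "{t..T}"]
    using d props(2)[OF h12] eq unfolding set_integrable_def[of _ "{t..T}"]
    by (intro integral_cong_AE borel_measurable_integrable)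
  finally show ?thesis by (simp add: duhamel_def)
qed

lemma duhamel_in_X_fun:
  assumes \<sigma>: "\<sigma> > 0" and h: "h \<in> X_fun T"
  shows "duhamel T \<sigma> \<beta> h \<in> X_fun T"
proof -
  obtain M where M: "M \<ge> 0" "AE p in X_meas T. \<bar>h p\<bar> \<le> M * (1 + snd p)"
    using h by (rule X_funE)
  note p = \<sigma> X_fun_measurable[OF h] M(2) M(1) const_integrable
  show ?thesis
  proof (rule X_funI)
    show "duhamel T \<sigma> \<beta> h \<in> borel_measurable (X_meas T)"
      by (rule duhamel_measurable[where \<phi> = "\<lambda>_. M", OF p])
    show "AE p in X_meas T. \<bar>duhamel T \<sigma> \<beta> h p\<bar> \<le> exp (\<bar>\<beta>\<bar> * T) * (T * M) * (1 + snd p)"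
    proof (rule AE_X_measI, unfold snd_conv)
      fix t S :: real assume t: "t \<in> {0..T}" and S: "S > 0"
      have "(LINT u:{t..T}|lborel. M) = (T - t) * M"
        using t by (simp add: set_lebesgue_integral_def)
      also have "\<dots> \<le> T * M" using t M(1) by (intro mult_right_mono) auto
      finally have "exp (\<bar>\<beta>\<bar> * T) * (LINT u:{t..T}|lborel. M) * (1 + S) \<le> exp (\<bar>\<beta>\<bar> * T) * (T * M) * (1 + S)"
        using S by (intro mult_right_mono mult_left_mono) auto
      with duhamel_bound[where \<phi> = "\<lambda>_. M" and \<beta> = \<beta>, OF p t S]
      show "\<bar>duhamel T \<sigma> \<beta> h (t, S)\<bar> \<le> exp (\<bar>\<beta>\<bar> * T) * (T * M) * (1 + S)" by (rule order_trans)
    qed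
  qed
qed

section \<open>The integral operator and its iterates\<close>

text \<open>
  One step of the iteration: the Volterra operator raises \<open>(C (T - t))\<^sup>n / n!\<close> to the next term of the
  exponential series.
\<close>

lemma integral_power_over_fact:
  fixes t T C M :: real
  assumes "t \<le> T"
  shows "(LINT u:{t..T}|lborel. M * (C * (T - u)) ^ n / fact n) * C = M * (C * (T - t)) ^ Suc n / fact (Suc n)"
proof -
  let ?F = "\<lambda>u. - (M * C ^ n * (T - u) ^ Suc n / fact (Suc n))"
  have "has_bochner_integral lborel (\<lambda>u. M * (C * (T - u)) ^ n / fact n * indicator {t..T} u) (?F T - ?F t)"
    using assms
  proof (rule has_bochner_integral_FTC_Icc_real)
    fix u :: real
    have "((\<lambda>u. (T - u) ^ Suc n) has_real_derivative (real (Suc n) * (T - u) ^ n * (-1))) (at u)"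
      by (rule derivative_eq_intros refl | simp)+
    then have "(?F has_real_derivative - (M * C ^ n * (real (Suc n) * (T - u) ^ n * (-1)) / fact (Suc n))) (at u)"
      by (intro DERIV_minus DERIV_cdivide DERIV_cmult)
    moreover have "- (M * C ^ n * (real (Suc n) * (T - u) ^ n * (-1)) / fact (Suc n)) = M * (C * (T - u)) ^ n / fact n"
      unfolding power_mult_distrib by (simp add: field_simps del: of_nat_Suc)
    ultimately show "(?F has_real_derivative M * (C * (T - u)) ^ n / fact n) (at u)"
      by (rule DERIV_cong)
    show "isCont (\<lambda>u. M * (C * (T - u)) ^ n / fact n) u" by (intro continuous_intros) simp
  qed
  then have "(LINT u|lborel. M * (C * (T - u)) ^ n / fact n * indicator {t..T} u) = ?F T - ?F t"
    by (rule has_bochner_integral_integral_eq)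
  then have "(LINT u:{t..T}|lborel. M * (C * (T - u)) ^ n / fact n) = ?F T - ?F t"
    unfolding set_lebesgue_integral_def real_scaleR_def by (simp only: mult.commute[of "indicator _ _"])
  then show ?thesis by (simp add: power_mult_distrib)
qed

text \<open>
  The hypotheses with the constants of linear growth and of the Lipschitz condition fixed.
\<close>

locale mild_equation =
  fixes T \<sigma> \<beta> :: real and F :: "real \<Rightarrow> real \<Rightarrow> real \<Rightarrow> real" and g :: "real \<Rightarrow> real" and c L :: real
  assumes T_pos: "T > 0" and sigma_pos: "\<sigma> > 0"
    and F_meas: "(\<lambda>(t, S, f). F t S f) \<in> borel_measurable (lebesgue_on ({0..T} \<times> {0..} \<times> UNIV))"
    and g_meas: "g \<in> borel_measurable (lebesgue_on {0..})"
    and c_pos: "c > 0" and L_pos: "L > 0"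
    and F_growth: "\<And>t S f. t \<in> {0..T} \<Longrightarrow> S \<ge> 0 \<Longrightarrow> \<bar>F t S f\<bar> \<le> c * (1 + \<bar>S\<bar> + \<bar>f\<bar>)"
    and g_growth: "\<And>S. S \<ge> 0 \<Longrightarrow> \<bar>g S\<bar> \<le> c * (1 + S)"
    and F_lipschitz: "\<And>t S S' f h. t \<in> {0..T} \<Longrightarrow> S \<ge> 0 \<Longrightarrow> S' \<ge> 0 \<Longrightarrow>
      \<bar>F t S f - F t S' h\<bar> \<le> L * (\<bar>S - S'\<bar> + \<bar>f - h\<bar>)"
begin

abbreviation "source x \<equiv> (\<lambda>(u, z). F u z (x (u, z)))"
abbreviation "Jf \<equiv> J_fun T \<sigma> \<beta> F g"
abbreviation "terminal t S \<equiv> (LINT z:{0<..}|lebesgue. gbm_Gamma \<sigma> \<beta> t S T z * g z)"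

definition rate :: real where "rate = exp (\<bar>\<beta>\<bar> * T) * L"

lemma rate_pos: "rate > 0"
  using L_pos by (simp add: rate_def)

lemma Jf_eq: "Jf x (t, S) = terminal t S - duhamel T \<sigma> \<beta> (source x) (t, S)"
  by (simp add: J_fun_def duhamel_def)

lemma source_in_X_fun:
  assumes "x \<in> X_fun T"
  shows "source x \<in> X_fun T"
proof -
  obtain M where M: "M \<ge> 0" "AE p in X_meas T. \<bar>x p\<bar> \<le> M * (1 + snd p)"
    using assms by (rule X_funE)
  show ?thesis
  proof (rule X_funI)
    show "source x \<in> borel_measurable (X_meas T)"
      by (rule superposition_measurable[OF F_meas F_lipschitz L_pos X_fun_measurable[OF assms]])
    show "AE p in X_meas T. \<bar>source x p\<bar> \<le> c * (1 + M) * (1 + snd p)"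
      using M(2) AE_X_meas_dom
    proof eventually_elim
      case (elim p)
      have "\<bar>source x p\<bar> \<le> c * (1 + \<bar>snd p\<bar> + \<bar>x p\<bar>)"
        using F_growth[of "fst p" "snd p" "x p"] elim by (simp add: case_prod_unfold)
      also have "\<dots> \<le> c * ((1 + M) * (1 + snd p))"
        using elim c_pos by (intro mult_left_mono) (auto simp: algebra_simps)
      finally show ?case by (simp add: mult.assoc)
    qed
  qed
qed

lemma payoff_borel:
  obtains g' where "g' \<in> borel_measurable borel" "AE z in lborel. z > 0 \<longrightarrow> g z = g' z"
    "AE z in lborel. z > 0 \<longrightarrow> \<bar>g' z\<bar> \<le> c * (1 + z)"
proof -
  obtain g' where g': "g' \<in> borel_measurable borel" "AE z in lborel. z \<in> {0..} \<longrightarrow> g z = g' z"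
    by (rule borel_measurable_lebesgue_onE[OF _ g_meas]) auto
  show ?thesis
  proof (rule that[OF g'(1)])
    show "AE z in lborel. z > 0 \<longrightarrow> g z = g' z"
      using g'(2) by eventually_elim auto
    show "AE z in lborel. z > 0 \<longrightarrow> \<bar>g' z\<bar> \<le> c * (1 + z)"
      using g'(2)
    proof eventually_elim
      case (elim z)
      then show ?case using g_growth[of z] by auto
    qed
  qed
qed

lemma terminal_integrable:
  assumes "t < T" "S > 0"
  shows "set_integrable lebesgue {0<..} (\<lambda>z. gbm_Gamma \<sigma> \<beta> t S T z * g z)"
proof -
  obtain g' where g': "g' \<in> borel_measurable borel" "AE z in lborel. z > 0 \<longrightarrow> g z = g' z"
    "AE z in lborel. z > 0 \<longrightarrow> \<bar>g' z\<bar> \<le> c * (1 + z)" by (rule payoff_borel)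
  show ?thesis
    unfolding Gamma_set_integral(2)[OF g'(1,2)]
    by (rule Gamma_integral_bound(1)[OF sigma_pos assms g'(1,3)])
qed

lemma terminal_in_X_fun: "(\<lambda>p. terminal (fst p) (snd p)) \<in> X_fun T"
proof -
  obtain g' where g': "g' \<in> borel_measurable borel" "AE z in lborel. z > 0 \<longrightarrow> g z = g' z"
    "AE z in lborel. z > 0 \<longrightarrow> \<bar>g' z\<bar> \<le> c * (1 + z)" by (rule payoff_borel)
  note eq = Gamma_set_integral(1)[OF g'(1,2)]
  show ?thesis
  proof (rule X_funI)
    have [measurable]: "g' \<in> borel_measurable borel" by (rule g')
    have "(\<lambda>p. LINT z|lborel. gbm_Gamma \<sigma> \<beta> (fst p) (snd p) T z * g' z) \<in> borel_measurable borel"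
      unfolding borel_prod[symmetric]
      by (intro lborel.borel_measurable_lebesgue_integral, unfold case_prod_unfold)
        (intro borel_measurable_times Gamma_measurable; measurable)
    then show "(\<lambda>p. terminal (fst p) (snd p)) \<in> borel_measurable (X_meas T)"
      unfolding X_meas_def eq
      by (intro measurable_restrict_space1 measurable_completion) simp
    show "AE p in X_meas T. \<bar>terminal (fst p) (snd p)\<bar> \<le> exp (\<bar>\<beta>\<bar> * T) * c * (1 + snd p)"
    proof (rule AE_X_measI, unfold fst_conv snd_conv)
      fix t S :: real assume t: "t \<in> {0..T}" and S: "S > 0"
      show "\<bar>terminal t S\<bar> \<le> exp (\<bar>\<beta>\<bar> * T) * c * (1 + S)"
      proof (cases "t < T")
        case True
        have "\<bar>terminal t S\<bar> \<le> c * (1 + S * exp (\<beta> * (T - t)))"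
          unfolding eq by (rule Gamma_integral_bound(2)[OF sigma_pos True S g'(1,3)])
        also have "\<dots> \<le> exp (\<bar>\<beta>\<bar> * T) * c * (1 + S)"
          by (rule Gamma_growth_le) (use t S c_pos in auto)
        finally show ?thesis .
      next
        case False
        with t have "t = T" by simp
        then show ?thesis using S c_pos by (simp add: gbm_Gamma_def set_lebesgue_integral_def)
      qed
    qed
  qed
qed

lemma integrals_exist:
  assumes x: "x \<in> X_fun T" and t: "t \<in> {0..<T}" and S: "S > 0"
  shows "J_integrals_exist T \<sigma> \<beta> F g x t S"
proof -
  have t': "t \<in> {0..T}" using t by auto
  obtain M where M: "M \<ge> 0" "AE p in X_meas T. \<bar>source x p\<bar> \<le> M * (1 + snd p)"
    using source_in_X_fun[OF x] by (rule X_funE)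
  note p = sigma_pos X_fun_measurable[OF source_in_X_fun[OF x]] M(2) M(1) const_integrable
  show ?thesis
    unfolding J_integrals_exist_def
    using terminal_integrable[of t S] t S
      duhamel_inner_integrable[where \<phi> = "\<lambda>_. M" and \<beta> = \<beta>, OF p t' S]
      duhamel_outer_integrable[where \<phi> = "\<lambda>_. M" and \<beta> = \<beta>, OF p t' S]
    by simp
qed

lemma Jf_in_X_fun: "x \<in> X_fun T \<Longrightarrow> Jf x \<in> X_fun T"
proof -
  assume x: "x \<in> X_fun T"
  have "Jf x = (\<lambda>p. terminal (fst p) (snd p) - duhamel T \<sigma> \<beta> (source x) p)"
    by (rule ext) (simp only: split_paired_all Jf_eq fst_conv snd_conv)
  then show ?thesis
    using X_fun_diff[OF terminal_in_X_fun duhamel_in_X_fun[OF sigma_pos source_in_X_fun[OF x]]] by simp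
qed

text \<open>
  The terminal terms cancel, the source difference is bounded by the Lipschitz condition in the last
  variable, and the estimate of the Duhamel integral applies. The hypothesis is an
  almost-everywhere bound but the conclusion holds at every point.
\<close>

lemma Jf_lipschitz:
  assumes x: "x \<in> X_fun T" and y: "y \<in> X_fun T"
    and \<phi>: "\<And>u. u \<in> {0..T} \<Longrightarrow> 0 \<le> \<phi> u" "set_integrable lborel {0..T} \<phi>"
    and bound: "AE p in X_meas T. \<bar>x p - y p\<bar> \<le> \<phi> (fst p) * (1 + snd p)"
    and t: "t \<in> {0..T}" and S: "S > 0"
  shows "\<bar>Jf x (t, S) - Jf y (t, S)\<bar> \<le> rate * (LINT u:{t..T}|lborel. \<phi> u) * (1 + S)"
proof -
  let ?h = "\<lambda>p. source x p - source y p"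
  have h: "?h \<in> X_fun T" by (intro X_fun_diff source_in_X_fun x y)
  have b: "AE p in X_meas T. \<bar>?h p\<bar> \<le> (L * \<phi> (fst p)) * (1 + snd p)"
    using bound AE_X_meas_dom
  proof eventually_elim
    case (elim p)
    have "\<bar>?h p\<bar> \<le> L * \<bar>x p - y p\<bar>"
      using F_lipschitz[of "fst p" "snd p" "snd p" "x p" "y p"] elim by (simp add: case_prod_unfold)
    also have "\<dots> \<le> L * (\<phi> (fst p) * (1 + snd p))"
      using elim L_pos by (intro mult_left_mono) auto
    finally show ?case by (simp add: mult.assoc)
  qed
  have "\<bar>Jf x (t, S) - Jf y (t, S)\<bar> = \<bar>duhamel T \<sigma> \<beta> ?h (t, S)\<bar>"
    unfolding Jf_eq
    using duhamel_diff[OF sigma_pos source_in_X_fun[OF x] source_in_X_fun[OF y] t S, of \<beta>]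
    by simp
  also have "\<dots> \<le> exp (\<bar>\<beta>\<bar> * T) * (LINT u:{t..T}|lborel. L * \<phi> u) * (1 + S)"
    by (rule duhamel_bound[where \<phi> = "\<lambda>u. L * \<phi> u", OF sigma_pos X_fun_measurable[OF h] b _ _ t S])
      (use \<phi> L_pos in auto)
  also have "(LINT u:{t..T}|lborel. L * \<phi> u) = L * (LINT u:{t..T}|lborel. \<phi> u)"
    by (simp add: set_integral_mult_right)
  finally show ?thesis by (simp add: rate_def mult_ac)
qed

text \<open>
  The case \<open>\<phi> = 0\<close>: changing \<open>x\<close> on a null set does not change \<open>J x\<close> at any point of the domain.
\<close>

lemma Jf_cong:
  assumes "(x, y) \<in> X_rel T" and t: "t \<in> {0..T}" and S: "S > 0"
  shows "Jf x (t, S) = Jf y (t, S)"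
proof -
  have "AE p in X_meas T. \<bar>x p - y p\<bar> \<le> 0 * (1 + snd p)"
    using assms by (auto simp: X_rel_def elim: eventually_mono)
  from Jf_lipschitz[where \<phi> = "\<lambda>_. 0", OF _ _ _ const_integrable this t S] assms(1)
  show ?thesis by (simp add: X_rel_def)
qed

lemma Jf_respects_X_rel:
  assumes "(x, y) \<in> X_rel T"
  shows "(Jf x, Jf y) \<in> X_rel T"
  using assms Jf_in_X_fun Jf_cong[OF assms] by (auto simp: X_rel_def intro!: AE_X_measI)

lemma Jf_pow_in_X_fun: "x \<in> X_fun T \<Longrightarrow> (Jf ^^ n) x \<in> X_fun T"
  by (induction n) (auto intro: Jf_in_X_fun)

text \<open>
  The induction hypothesis is itself a bound of the form \<open>\<phi>(t) (1 + S)\<close>, so \<open>Jf_lipschitz\<close> applies to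
  it and integrates \<open>\<phi>\<close> once more from \<open>t\<close> to \<open>T\<close>.
\<close>

lemma Jf_pow_bound_time:
  assumes x: "x \<in> X_fun T" and y: "y \<in> X_fun T" and M: "M \<ge> 0"
    and bound: "AE p in X_meas T. \<bar>x p - y p\<bar> \<le> M * (1 + snd p)"
  shows "AE p in X_meas T. \<bar>(Jf ^^ n) x p - (Jf ^^ n) y p\<bar>
      \<le> M * (rate * (T - fst p)) ^ n / fact n * (1 + snd p)"
proof (induction n)
  case 0
  then show ?case using bound by simp
next
  case (Suc n)
  let ?\<phi> = "\<lambda>u. M * (rate * (T - u)) ^ n / fact n"
  show ?case
  proof (rule AE_X_measI, unfold fst_conv snd_conv)
    fix t S :: real assume t: "t \<in> {0..T}" and S: "S > 0"
    have "\<bar>Jf ((Jf ^^ n) x) (t, S) - Jf ((Jf ^^ n) y) (t, S)\<bar> \<le> rate * (LINT u:{t..T}|lborel. ?\<phi> u) * (1 + S)"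
    proof (rule Jf_lipschitz[OF Jf_pow_in_X_fun[OF x] Jf_pow_in_X_fun[OF y] _ _ Suc.IH t S])
      show "0 \<le> ?\<phi> u" if "u \<in> {0..T}" for u using that M rate_pos by simp
      show "set_integrable lborel {0..T} ?\<phi>"
        by (intro borel_integrable_atLeastAtMost' continuous_intros) simp
    qed
    also have "rate * (LINT u:{t..T}|lborel. ?\<phi> u) = M * (rate * (T - t)) ^ Suc n / fact (Suc n)"
      using integral_power_over_fact[of t T M rate n] t by (simp add: mult.commute)
    finally show "\<bar>(Jf ^^ Suc n) x (t, S) - (Jf ^^ Suc n) y (t, S)\<bar>
        \<le> M * (rate * (T - t)) ^ Suc n / fact (Suc n) * (1 + S)" by simp
  qed
qed

definition contraction_factor :: "nat \<Rightarrow> real" where "contraction_factor n = (rate * T) ^ n / fact n"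

lemma contraction_factor_nonneg: "contraction_factor n \<ge> 0"
  using rate_pos T_pos by (simp add: contraction_factor_def)

lemma contraction_factor_summable: "summable contraction_factor"
  using summable_exp[of "rate * T"] by (simp add: contraction_factor_def[abs_def] field_simps)

text \<open>
  The bound of the previous lemma is largest at \<open>t = 0\<close>.
\<close>

lemma Jf_pow_bound:
  assumes x: "x \<in> X_fun T" and y: "y \<in> X_fun T" and M: "M \<ge> 0"
    and bound: "AE p in X_meas T. \<bar>x p - y p\<bar> \<le> M * (1 + snd p)"
  shows "AE p in X_meas T. \<bar>(Jf ^^ n) x p - (Jf ^^ n) y p\<bar> \<le> M * contraction_factor n * (1 + snd p)"
  using Jf_pow_bound_time[OF assms, of n] AE_X_meas_dom
proof eventually_elim
  case (elim p)
  have "(rate * (T - fst p)) ^ n \<le> (rate * T) ^ n"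
    using elim(2) rate_pos by (intro power_mono mult_left_mono) auto
  then have "M * (rate * (T - fst p)) ^ n / fact n * (1 + snd p) \<le> M * (rate * T) ^ n / fact n * (1 + snd p)"
    using M elim(2) by (intro mult_right_mono divide_right_mono mult_left_mono) auto
  with elim(1) show ?case by (simp add: contraction_factor_def)
qed

lemma J_class:
  assumes "x \<in> X_fun T"
  shows "J T \<sigma> \<beta> F g (X_rel T `` {x}) = X_rel T `` {Jf x}"
  unfolding J_def
  by (rule UN_equiv_class[OF equiv_X_rel _ assms])
    (auto simp: congruent_def intro!: equiv_class_eq[OF equiv_X_rel] Jf_respects_X_rel)

lemma J_pow_class:
  assumes "x \<in> X_fun T"
  shows "(J T \<sigma> \<beta> F g ^^ n) (X_rel T `` {x}) = X_rel T `` {(Jf ^^ n) x}"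
  by (induction n) (simp_all add: J_class Jf_pow_in_X_fun assms)

lemma J_maps_X_space: "J T \<sigma> \<beta> F g \<in> X_space T \<rightarrow> X_space T"
proof
  fix A assume "A \<in> X_space T"
  then obtain x where "x \<in> X_fun T" "A = X_rel T `` {x}"
    unfolding X_space_def by (rule quotientE)
  then show "J T \<sigma> \<beta> F g A \<in> X_space T"
    by (simp add: J_class X_space_def quotientI Jf_in_X_fun)
qed

lemma X_norm_diff_class:
  assumes "x \<in> X_fun T" "y \<in> X_fun T"
  shows "X_norm T (X_diff T (X_rel T `` {x}) (X_rel T `` {y})) = real_of_ereal (rep_esssup T (\<lambda>p. x p - y p))"
  using assms by (simp add: X_diff_class X_norm_class X_fun_diff)

text \<open>
  Distinct classes have a positive distance \<open>N\<close>, since a bound \<open>N \<le> 0\<close> would make the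
  representatives agree almost everywhere.
\<close>

lemma J_pow_contraction:
  assumes k: "contraction_factor k < 1" and A: "A \<in> X_space T" and B: "B \<in> X_space T" and AB: "A \<noteq> B"
  shows "X_norm T (X_diff T ((J T \<sigma> \<beta> F g ^^ k) A) ((J T \<sigma> \<beta> F g ^^ k) B)) < X_norm T (X_diff T A B)"
proof -
  obtain x where x: "x \<in> X_fun T" "A = X_rel T `` {x}"
    using A unfolding X_space_def by (rule quotientE)
  obtain y where y: "y \<in> X_fun T" "B = X_rel T `` {y}"
    using B unfolding X_space_def by (rule quotientE)
  define N where "N = real_of_ereal (rep_esssup T (\<lambda>p. x p - y p))"
  have bound: "AE p in X_meas T. \<bar>x p - y p\<bar> \<le> N * (1 + snd p)"
    unfolding N_def by (rule rep_esssup_bound[OF X_fun_diff[OF x(1) y(1)]])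
  have N: "N > 0"
  proof (rule ccontr)
    assume "\<not> N > 0"
    have "AE p in X_meas T. x p = y p"
      using bound AE_X_meas_dom
    proof eventually_elim
      case (elim p)
      then have "N * (1 + snd p) \<le> 0" using \<open>\<not> N > 0\<close> by (intro mult_nonpos_nonneg) auto
      with elim(1) show ?case by simp
    qed
    then have "(x, y) \<in> X_rel T" using x y by (simp add: X_rel_def)
    then show False using AB x(2) y(2) equiv_class_eq[OF equiv_X_rel] by blast
  qed
  have "rep_esssup T (\<lambda>p. (Jf ^^ k) x p - (Jf ^^ k) y p) \<le> ereal (N * contraction_factor k)"
    using N Jf_pow_bound[OF x(1) y(1) _ bound, of k]
    by (intro rep_esssup_le X_fun_measurable X_fun_diff Jf_pow_in_X_fun x y) auto
  moreover have "N * contraction_factor k \<ge> 0" using N contraction_factor_nonneg by simp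
  ultimately have "real_of_ereal (rep_esssup T (\<lambda>p. (Jf ^^ k) x p - (Jf ^^ k) y p)) \<le> N * contraction_factor k"
    by (cases "rep_esssup T (\<lambda>p. (Jf ^^ k) x p - (Jf ^^ k) y p)") auto
  also have "\<dots> < N" using N k by simp
  finally show ?thesis
    by (simp add: x y J_pow_class X_norm_diff_class Jf_pow_in_X_fun N_def)
qed

lemma contraction_factor_tail: "(\<lambda>n. \<Sum>k. contraction_factor (k + n)) \<longlonglongrightarrow> 0"
  using suminf_exist_split2[OF contraction_factor_summable] by simp

section \<open>The fixed point\<close>

text \<open>
  The Picard iterates are \<open>x n\<close>, and \<open>v\<close> is the sum of their increments \<open>d n\<close>. These are
  dominated by a summable sequence times the weight \<open>1 + S\<close>, so that \<open>v\<close> exists almost everywhere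
  as a pointwise limit and the tails \<open>\<epsilon> n\<close> bound the error in the weighted norm. Then
  \<open>|v - J v| \<le> |v - x (n + 1)| + |J (x n) - J v|\<close>, and both terms tend to \<open>0\<close>.
\<close>

lemma fixed_point_exists:
  obtains v where "v \<in> X_fun T" "AE p in X_meas T. v p = Jf v p"
proof -
  define x where "x n = (Jf ^^ n) (\<lambda>_. 0)" for n
  have zero: "(\<lambda>_. 0) \<in> X_fun T" by (rule X_funI[of _ _ 0]) auto
  have x: "x n \<in> X_fun T" for n unfolding x_def by (rule Jf_pow_in_X_fun[OF zero])
  obtain M where M: "M \<ge> 0" "AE p in X_meas T. \<bar>Jf (\<lambda>_. 0) p\<bar> \<le> M * (1 + snd p)"
    using Jf_in_X_fun[OF zero] by (rule X_funE)
  define d where "d n p = x (Suc n) p - x n p" for n p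
  have d: "AE p in X_meas T. \<bar>d n p\<bar> \<le> M * contraction_factor n * (1 + snd p)" for n
    using Jf_pow_bound[OF Jf_in_X_fun[OF zero] zero M(1), of n] M(2)
    by (simp add: d_def x_def funpow_swap1)
  have all_d: "AE p in X_meas T. \<forall>n. \<bar>d n p\<bar> \<le> M * contraction_factor n * (1 + snd p)"
    unfolding AE_all_countable using d by blast
  define v where "v p = (\<Sum>n. d n p)" for p
  define \<epsilon> where "\<epsilon> n = M * (\<Sum>k. contraction_factor (k + n))" for n
  have tail: "AE p in X_meas T. \<forall>n. \<bar>v p - x n p\<bar> \<le> \<epsilon> n * (1 + snd p)"
    using all_d AE_X_meas_dom
  proof eventually_elim
    case (elim p)
    have s: "summable (\<lambda>k. M * contraction_factor (k + n) * (1 + snd p))" for n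
      by (intro summable_mult summable_mult2 summable_ignore_initial_segment contraction_factor_summable)
    have sd: "summable (\<lambda>k. d k p)"
      by (rule summable_comparison_test'[where N = 0, OF s[of 0]]) (use elim in auto)
    show ?case
    proof
      fix n
      have sn: "summable (\<lambda>k. \<bar>d (k + n) p\<bar>)"
        by (rule summable_comparison_test'[where N = 0, OF s[of n]]) (use elim in auto)
      have "x n p = (\<Sum>k<n. d k p)"
        unfolding d_def using sum_lessThan_telescope[of "\<lambda>k. x k p" n] by (simp add: x_def)
      then have "v p - x n p = (\<Sum>k. d (k + n) p)"
        using suminf_minus_initial_segment[OF sd, of n] by (simp add: v_def)
      also have "\<bar>\<dots>\<bar> \<le> (\<Sum>k. \<bar>d (k + n) p\<bar>)" by (rule summable_rabs[OF sn])
      also have "\<dots> \<le> (\<Sum>k. M * contraction_factor (k + n) * (1 + snd p))"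
        by (rule suminf_le[OF _ sn s]) (use elim in auto)
      also have "\<dots> = \<epsilon> n * (1 + snd p)"
        unfolding \<epsilon>_def
        by (simp add: suminf_mult suminf_mult2[symmetric] summable_ignore_initial_segment
            summable_mult contraction_factor_summable)
      finally show "\<bar>v p - x n p\<bar> \<le> \<epsilon> n * (1 + snd p)" .
    qed
  qed
  have \<epsilon>0: "\<epsilon> n \<ge> 0" for n
    unfolding \<epsilon>_def using M(1) contraction_factor_summable contraction_factor_nonneg
    by (intro mult_nonneg_nonneg suminf_nonneg summable_ignore_initial_segment) auto
  have \<epsilon>: "\<epsilon> \<longlonglongrightarrow> 0"
    unfolding \<epsilon>_def[abs_def] using tendsto_mult_right_zero[OF contraction_factor_tail] .
  have v: "v \<in> X_fun T"
  proof (rule X_funI)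
    have "d n \<in> borel_measurable (X_meas T)" for n
      unfolding d_def[abs_def] by (intro X_fun_measurable X_fun_diff x)
    then show "v \<in> borel_measurable (X_meas T)"
      unfolding v_def[abs_def] by (rule borel_measurable_suminf)
    show "AE p in X_meas T. \<bar>v p\<bar> \<le> \<epsilon> 0 * (1 + snd p)"
      using tail by eventually_elim (auto simp: x_def dest: spec[of _ 0])
  qed
  have J: "\<bar>Jf v (t, S) - x (Suc n) (t, S)\<bar> \<le> rate * (T * \<epsilon> n) * (1 + S)"
    if t: "t \<in> {0..T}" and S: "S > 0" for n t S
  proof -
    have "AE p in X_meas T. \<bar>v p - x n p\<bar> \<le> \<epsilon> n * (1 + snd p)"
      using tail by eventually_elim simp
    from Jf_lipschitz[where \<phi> = "\<lambda>_. \<epsilon> n", OF v x \<epsilon>0 const_integrable this t S]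
    have "\<bar>Jf v (t, S) - x (Suc n) (t, S)\<bar> \<le> rate * (LINT u:{t..T}|lborel. \<epsilon> n) * (1 + S)"
      by (simp add: x_def)
    also have "(LINT u:{t..T}|lborel. \<epsilon> n) = (T - t) * \<epsilon> n"
      using t by (simp add: set_lebesgue_integral_def)
    also have "rate * ((T - t) * \<epsilon> n) * (1 + S) \<le> rate * (T * \<epsilon> n) * (1 + S)"
      using t S \<epsilon>0 rate_pos by (intro mult_right_mono mult_left_mono) auto
    finally show ?thesis .
  qed
  have "AE p in X_meas T. v p = Jf v p"
    using tail AE_X_meas_dom
  proof eventually_elim
    case (elim p)
    have "\<bar>v p - Jf v p\<bar> \<le> (\<epsilon> (Suc n) + rate * (T * \<epsilon> n)) * (1 + snd p)" for n
      using elim(1)[rule_format, of "Suc n"] J[of "fst p" "snd p" n] elim(2)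
      by (simp add: distrib_right)
    moreover have "(\<lambda>n. (\<epsilon> (Suc n) + rate * (T * \<epsilon> n)) * (1 + snd p)) \<longlonglongrightarrow> (0 + rate * (T * 0)) * (1 + snd p)"
      by (intro tendsto_intros \<epsilon> LIMSEQ_Suc)
    ultimately have "\<bar>v p - Jf v p\<bar> \<le> 0"
      by (intro LIMSEQ_le_const) auto
    then show ?case by simp
  qed
  with v show ?thesis by (rule that)
qed

lemma Jf_pow_fixed_point:
  assumes v: "v \<in> X_fun T" "AE p in X_meas T. v p = Jf v p"
  shows "(v, (Jf ^^ n) v) \<in> X_rel T"
proof (induction n)
  case 0
  show ?case using v by (simp add: X_rel_def)
next
  case (Suc n)
  have "(v, Jf v) \<in> X_rel T" using v Jf_in_X_fun by (simp add: X_rel_def)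
  moreover have "(Jf v, (Jf ^^ Suc n) v) \<in> X_rel T" using Jf_respects_X_rel[OF Suc.IH] by simp
  ultimately show ?case using equiv_X_rel by (meson equivE transE)
qed

text \<open>
  Two fixed points are also fixed by all iterates, so their distance is bounded by
  \<open>M (E L T)\<^sup>n / n!\<close> for every \<open>n\<close>.
\<close>

lemma fixed_point_unique:
  assumes v: "v \<in> X_fun T" "AE p in X_meas T. v p = Jf v p"
    and w: "w \<in> X_fun T" "AE p in X_meas T. w p = Jf w p"
  shows "(v, w) \<in> X_rel T"
proof -
  obtain M where M: "M \<ge> 0" "AE p in X_meas T. \<bar>v p - w p\<bar> \<le> M * (1 + snd p)"
    using X_fun_diff[OF v(1) w(1)] by (rule X_funE)
  have "AE p in X_meas T. \<bar>v p - w p\<bar> \<le> M * contraction_factor n * (1 + snd p)" for n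
  proof -
    have "AE p in X_meas T. v p = (Jf ^^ n) v p" "AE p in X_meas T. w p = (Jf ^^ n) w p"
      using Jf_pow_fixed_point[OF v] Jf_pow_fixed_point[OF w] by (simp_all add: X_rel_def)
    with Jf_pow_bound[OF v(1) w(1) M, of n] show ?thesis by eventually_elim simp
  qed
  then have "AE p in X_meas T. \<forall>n. \<bar>v p - w p\<bar> \<le> M * contraction_factor n * (1 + snd p)"
    by (simp add: AE_all_countable)
  then have "AE p in X_meas T. v p = w p"
  proof eventually_elim
    case (elim p)
    have "(\<lambda>n. M * contraction_factor n * (1 + snd p)) \<longlonglongrightarrow> M * 0 * (1 + snd p)"
      by (intro tendsto_intros summable_LIMSEQ_zero contraction_factor_summable)
    then have "\<bar>v p - w p\<bar> \<le> 0" using elim by (intro LIMSEQ_le_const) auto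
    then show ?case by simp
  qed
  with v w show ?thesis by (simp add: X_rel_def)
qed

text \<open>
  Every member of the class of a fixed point solves the equation almost everywhere, since \<open>J\<close> depends on
  the class only.
\<close>

lemma unique_solution:
  "\<exists>!V. V \<in> X_space T \<and> (\<forall>v\<in>V. AE p in X_meas T. v p = Jf v p)"
proof -
  obtain v where v: "v \<in> X_fun T" "AE p in X_meas T. v p = Jf v p"
    by (rule fixed_point_exists)
  show ?thesis
  proof (rule ex1I[of _ "X_rel T `` {v}"], intro conjI ballI)
    show "X_rel T `` {v} \<in> X_space T" using v by (simp add: X_space_def quotientI)
    fix w assume "w \<in> X_rel T `` {v}"
    then have vw: "(v, w) \<in> X_rel T" by simp
    then have "AE p in X_meas T. v p = w p" "AE p in X_meas T. Jf v p = Jf w p"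
      using Jf_respects_X_rel[OF vw] by (simp_all add: X_rel_def)
    with v(2) show "AE p in X_meas T. w p = Jf w p" by eventually_elim simp
  next
    fix W assume W: "W \<in> X_space T \<and> (\<forall>w\<in>W. AE p in X_meas T. w p = Jf w p)"
    then obtain w where w: "w \<in> X_fun T" "W = X_rel T `` {w}"
      unfolding X_space_def by (auto elim: quotientE)
    have "w \<in> W" using w by (simp add: X_rel_def)
    with W have "AE p in X_meas T. w p = Jf w p" by blast
    from fixed_point_unique[OF w(1) this v] show "W = X_rel T `` {v}"
      unfolding w(2) by (rule equiv_class_eq[OF equiv_X_rel])
  qed
qed

end

theorem theorem1:
  fixes T \<sigma> \<beta> :: real
    and F :: "real \<Rightarrow> real \<Rightarrow> real \<Rightarrow> real"
    and g :: "real \<Rightarrow> real"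
  assumes T_pos: "T > 0"
    and sigma_pos: "\<sigma> > 0"
    and F_meas: "(\<lambda>(t, S, f). F t S f) \<in> borel_measurable (lebesgue_on ({0..T} \<times> {0..} \<times> UNIV))"
    and g_meas: "g \<in> borel_measurable (lebesgue_on {0..})"
    and growth: "\<exists>c>0. (\<forall>t\<in>{0..T}. \<forall>S\<ge>0. \<forall>f. \<bar>F t S f\<bar> \<le> c * (1 + \<bar>S\<bar> + \<bar>f\<bar>))
                       \<and> (\<forall>S\<ge>0. \<bar>g S\<bar> \<le> c * (1 + S))"
    and lipschitz: "\<exists>L>0. \<forall>t\<in>{0..T}. \<forall>S\<ge>0. \<forall>S'\<ge>0. \<forall>f h.
                       \<bar>F t S f - F t S' h\<bar> \<le> L * (\<bar>S - S'\<bar> + \<bar>f - h\<bar>)"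
  shows "(\<forall>x\<in>X_fun T. \<forall>t\<in>{0..<T}. \<forall>S>0. J_integrals_exist T \<sigma> \<beta> F g x t S)
       \<and> (\<forall>x\<in>X_fun T. J_fun T \<sigma> \<beta> F g x \<in> X_fun T)
       \<and> (\<forall>(x, y)\<in>X_rel T. (J_fun T \<sigma> \<beta> F g x, J_fun T \<sigma> \<beta> F g y) \<in> X_rel T)
       \<and> J T \<sigma> \<beta> F g \<in> X_space T \<rightarrow> X_space T
       \<and> (\<exists>k::nat. \<forall>x\<in>X_space T. \<forall>y\<in>X_space T. x \<noteq> y \<longrightarrow>
            X_norm T (X_diff T ((J T \<sigma> \<beta> F g ^^ k) x) ((J T \<sigma> \<beta> F g ^^ k) y))
              < X_norm T (X_diff T x y))
       \<and> (\<exists>!V. V \<in> X_space T \<and>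
            (\<forall>v\<in>V. AE p in X_meas T. v p = J_fun T \<sigma> \<beta> F g v p))"
proof -
  obtain c where c: "c > 0" "\<forall>t\<in>{0..T}. \<forall>S\<ge>0. \<forall>f. \<bar>F t S f\<bar> \<le> c * (1 + \<bar>S\<bar> + \<bar>f\<bar>)"
    "\<forall>S\<ge>0. \<bar>g S\<bar> \<le> c * (1 + S)" using growth by blast
  obtain L where L: "L > 0" "\<forall>t\<in>{0..T}. \<forall>S\<ge>0. \<forall>S'\<ge>0. \<forall>f h.
      \<bar>F t S f - F t S' h\<bar> \<le> L * (\<bar>S - S'\<bar> + \<bar>f - h\<bar>)" using lipschitz by blast
  interpret mild_equation T \<sigma> \<beta> F g c L
    using T_pos sigma_pos F_meas g_meas c L by unfold_locales blast+
  have "\<forall>\<^sub>F k in sequentially. contraction_factor k < 1"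
    using summable_LIMSEQ_zero[OF contraction_factor_summable] by (rule order_tendstoD) simp
  then obtain k where k: "contraction_factor k < 1"
    by (metis eventually_sequentially order_refl)
  show ?thesis
  proof (intro conjI)
    show "\<exists>k::nat. \<forall>x\<in>X_space T. \<forall>y\<in>X_space T. x \<noteq> y \<longrightarrow>
        X_norm T (X_diff T ((J T \<sigma> \<beta> F g ^^ k) x) ((J T \<sigma> \<beta> F g ^^ k) y)) < X_norm T (X_diff T x y)"
      using J_pow_contraction[OF k] by blast
  qed (use integrals_exist Jf_in_X_fun Jf_respects_X_rel J_maps_X_space unique_solution in auto)
qed

end
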